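(* For $-M\le r<M$ assume that $f_r(z)$ has winding number zero, a Wiener--Hopf factorization $f_r(z)=f_r^+(z)f_r^-(z)$ and is analytic in $1-\epsilon_r<|z|<1+\epsilon_r$ for some $\epsilon_r>0$. Let $a(z)=\prod_{\ell=-M}^{M-1}f_\ell(z)$, with Fourier coefficients $\hat a_n$, and suppose that $$\sum_{n\in\mathbb{Z}}|n|^\alpha|\hat a_n|<\infty$$ for some $\alpha>0$. Set $\epsilon=\min\epsilon_r$ and, for $-M<r,s<M$, $$\tilde{\mathcal K}^M_{r,s}(z,w)=\frac{z}{z-w}G(z,w),\qquad G(z,w)=\frac{\prod_{t=r}^{M-1}f_t^-(\frac1z)\prod_{t=-M}^{s-1}f_t^+(\frac1w)}{\prod_{t=-M}^{r-1}f_t^+(\frac1z)\prod_{t=s}^{M-1}f_t^-(\frac1w)}.$$ Then, for $1-\epsilon<|w|<1<|z|<1+\epsilon$, $$\Big|\tilde{\mathcal K}^{n,M}_{r,s}(z,w)-\tilde{\mathcal K}^M_{r,s}(z,w)\Big|\le\frac{|f_{r,M}(\frac1z)|\,|f_{-M,s}(\frac1w)|}{(|z|-1)(1-|w|)}\Big(\frac1{n^\alpha}+|w|^{n/2}+\frac1{|z|^{n/2}}\Big).$$ Furthermore, $$\phi_{r,s}(x,y)=\frac1{2\pi}\int_{-\pi}^{\pi}e^{i(y-x)\theta}G(e^{i\theta},e^{i\theta})\,d\theta$$ for $r<s$ (and $x,y\in\mathbb{Z}$).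
   Context: $M\ge1$ is an integer and each $f_r$ is a function in $L^1(\mathbb{T})$, $\mathbb{T}$ the unit circle. $\hat f(k)$ denotes the $k$-th Fourier coefficient of $f$. In the Wiener--Hopf factorization, $f_r^+$ has a Fourier series with only nonnegative powers of $z$ and extends without zeros to $|z|\le1$, and $f_r^-$ has one with only nonpositive powers and extends without zeros to $\{|z|\ge1\}\cup\{\infty\}$. For $r<s$ put $f_{r,s}(z)=\prod_{\ell=r}^{s-1}f_\ell(z)$ and $\phi_{r,s}(x,y)=\hat f_{r,s}(y-x)$, $x,y\in\mathbb{Z}$; thus $\phi_{r,s}$ is the iterated convolution over $\mathbb{Z}$ of the transition weights $\phi_{t,t+1}(x,y)=\hat f_t(y-x)$, $r\le t<s$. The initial and final configurations are $x_j^{-M}=x_j^M=1-j$, $j=1,\dots,n$. Let $A$ be the $n\times n$ matrix with $A_{ij}=\phi_{-M,M}(x_i^{-M},x_j^M)=\hat a_{i-j}$, a Toeplitz matrix with symbol $a$, assumed to satisfy $\det A\ne0$. Define $$\tilde K^{n,M}(r,x;s,y)=\sum_{i,j=1}^n\phi_{r,M}(x,x_i^M)(A^{-1})_{ij}\phi_{-M,s}(x_j^{-M},y),\qquad\tilde{\mathcal K}^{n,M}_{r,s}(z,w)=\sum_{x,y\in\mathbb{Z}}\tilde K^{n,M}(r,x;s,y)z^xw^{-y}.$$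
   Formalization: The bound carries a constant C depending on the f_r, ε_r, M and α but not on n, r, s, z, w (without one it fails for small constant f_r); w ≠ 0 and analyticity of f_t, t<s, on 1≤|u|≤1/|w| are required so that f_t(1/w) and the series in w make sense. *)

theory Defs
  imports
    "HOL-Complex_Analysis.Complex_Analysis"
    "Jordan_Normal_Form.Determinant"
    "Jordan_Normal_Form.Gauss_Jordan_Elimination"
begin

definition fourier_coeff :: "(complex \<Rightarrow> complex) \<Rightarrow> int \<Rightarrow> complex" where
  "fourier_coeff f k =
     integral {-pi..pi} (\<lambda>\<theta>. f (cis \<theta>) * cis (- (of_int k * \<theta>))) / (2 * of_real pi)"

text \<open>
  The factor \<open>fp\<close> is given on the closed unit disc and \<open>fm\<close> on the closed exterior of the
  unit circle together with the point at infinity. "Extends" is read as: analytic in the open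
  region and continuous up to the circle. The product identity is required on the circle only,
  and nothing is assumed about \<open>fp\<close> outside the disc or \<open>fm\<close> inside it.
\<close>

definition wiener_hopf ::
    "(complex \<Rightarrow> complex) \<Rightarrow> (complex \<Rightarrow> complex) \<Rightarrow> (complex \<Rightarrow> complex) \<Rightarrow> bool" where
  "wiener_hopf f fp fm \<longleftrightarrow>
     (\<forall>z. norm z = 1 \<longrightarrow> f z = fp z * fm z) \<and>
     (\<forall>k<0. fourier_coeff fp k = 0) \<and>
     continuous_on {z. norm z \<le> 1} fp \<and> fp holomorphic_on {z. norm z < 1} \<and>
     (\<forall>z. norm z \<le> 1 \<longrightarrow> fp z \<noteq> 0) \<and>
     (\<forall>k>0. fourier_coeff fm k = 0) \<and>
     continuous_on {z. norm z \<ge> 1} fm \<and> fm holomorphic_on {z. norm z > 1} \<and>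
     (\<forall>z. norm z \<ge> 1 \<longrightarrow> fm z \<noteq> 0) \<and>
     (\<exists>L. L \<noteq> 0 \<and> (fm \<longlongrightarrow> L) at_infinity)"

text \<open>
  The factors have to be evaluated across the unit circle as well. Where \<open>f\<close> is analytic, the
  analytic continuation of \<open>fp\<close> to \<open>norm z > 1\<close> is \<open>f / fm\<close>, and that of \<open>fm\<close> to
  \<open>norm z < 1\<close> is \<open>f / fp\<close>.
\<close>

definition wh_plus ::
    "(complex \<Rightarrow> complex) \<Rightarrow> (complex \<Rightarrow> complex) \<Rightarrow> (complex \<Rightarrow> complex) \<Rightarrow> complex \<Rightarrow> complex" where
  "wh_plus f fp fm z = (if norm z \<le> 1 then fp z else f z / fm z)"

definition wh_minus ::
    "(complex \<Rightarrow> complex) \<Rightarrow> (complex \<Rightarrow> complex) \<Rightarrow> (complex \<Rightarrow> complex) \<Rightarrow> complex \<Rightarrow> complex" where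
  "wh_minus f fp fm z = (if norm z \<ge> 1 then fm z else f z / fp z)"

definition fprod :: "(int \<Rightarrow> complex \<Rightarrow> complex) \<Rightarrow> int \<Rightarrow> int \<Rightarrow> complex \<Rightarrow> complex" where
  "fprod f r s z = (\<Prod>l\<in>{r..<s}. f l z)"

definition phi :: "(int \<Rightarrow> complex \<Rightarrow> complex) \<Rightarrow> int \<Rightarrow> int \<Rightarrow> int \<Rightarrow> int \<Rightarrow> complex" where
  "phi f r s x y = fourier_coeff (fprod f r s) (y - x)"

definition endpoint :: "nat \<Rightarrow> int" where
  "endpoint j = 1 - int j"

text \<open>Matrix indices start at 0, those of the points \<open>endpoint\<close> at 1.\<close>

definition toepA :: "(int \<Rightarrow> complex \<Rightarrow> complex) \<Rightarrow> int \<Rightarrow> nat \<Rightarrow> complex mat" where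
  "toepA f M n = Matrix.mat n n (\<lambda>(i, j). phi f (- M) M (endpoint (Suc i)) (endpoint (Suc j)))"

text \<open>\<open>the (mat_inverse A)\<close> is the inverse of \<open>A\<close> whenever its determinant is nonzero.\<close>

definition Ktilde ::
    "(int \<Rightarrow> complex \<Rightarrow> complex) \<Rightarrow> int \<Rightarrow> nat \<Rightarrow> int \<Rightarrow> int \<Rightarrow> int \<Rightarrow> int \<Rightarrow> complex" where
  "Ktilde f M n r x s y =
     (\<Sum>i\<in>{1..n}. \<Sum>j\<in>{1..n}.
        phi f r M x (endpoint i) * (the (mat_inverse (toepA f M n)) $$ (i - 1, j - 1))
          * phi f (- M) s (endpoint j) y)"

definition Kgen_term ::
    "(int \<Rightarrow> complex \<Rightarrow> complex) \<Rightarrow> int \<Rightarrow> nat \<Rightarrow> int \<Rightarrow> int \<Rightarrow> complex \<Rightarrow> complex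
       \<Rightarrow> int \<times> int \<Rightarrow> complex" where
  "Kgen_term f M n r s z w = (\<lambda>(x, y). Ktilde f M n r x s y * z powi x * w powi (- y))"

definition Kgen ::
    "(int \<Rightarrow> complex \<Rightarrow> complex) \<Rightarrow> int \<Rightarrow> nat \<Rightarrow> int \<Rightarrow> int \<Rightarrow> complex \<Rightarrow> complex \<Rightarrow> complex" where
  "Kgen f M n r s z w = (\<Sum>\<^sub>\<infinity>p\<in>UNIV. Kgen_term f M n r s z w p)"

definition Gfun ::
    "(int \<Rightarrow> complex \<Rightarrow> complex) \<Rightarrow> (int \<Rightarrow> complex \<Rightarrow> complex) \<Rightarrow> (int \<Rightarrow> complex \<Rightarrow> complex)
       \<Rightarrow> int \<Rightarrow> int \<Rightarrow> int \<Rightarrow> complex \<Rightarrow> complex \<Rightarrow> complex" where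
  "Gfun f fp fm M r s z w =
     ((\<Prod>t\<in>{r..<M}. wh_minus (f t) (fp t) (fm t) (1 / z))
        * (\<Prod>t\<in>{- M..<s}. wh_plus (f t) (fp t) (fm t) (1 / w))) /
     ((\<Prod>t\<in>{- M..<r}. wh_plus (f t) (fp t) (fm t) (1 / z))
        * (\<Prod>t\<in>{s..<M}. wh_minus (f t) (fp t) (fm t) (1 / w)))"

definition Kinf ::
    "(int \<Rightarrow> complex \<Rightarrow> complex) \<Rightarrow> (int \<Rightarrow> complex \<Rightarrow> complex) \<Rightarrow> (int \<Rightarrow> complex \<Rightarrow> complex)
       \<Rightarrow> int \<Rightarrow> int \<Rightarrow> int \<Rightarrow> complex \<Rightarrow> complex \<Rightarrow> complex" where
  "Kinf f fp fm M r s z w = z / (z - w) * Gfun f fp fm M r s z w"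

end

theory Submission
  imports Defs "HOL-Real_Asymp.Real_Asymp"
begin

text \<open>
  Let \<open>A\<close> be the Toeplitz matrix and \<open>a = a\<^sub>+ a\<^sub>-\<close> the product of the factorizations. Summing over
  \<open>x\<close> and \<open>y\<close> turns the kernel into
  \<open>f\<^bsub>r,M\<^esub>(1/z) f\<^bsub>-M,s\<^esub>(1/w) P(1/z)\<close>, where the polynomial \<open>P\<close> has the coefficient vector
  \<open>A\<^sup>-\<^sup>1 (1, w, w\<^sup>2, \<dots>)\<close>. Thus \<open>a P\<close> has the coefficients \<open>w\<^sup>k\<close> for \<open>0 \<le> k < n\<close>, a part \<open>L\<close> on
  negative and a part \<open>R\<close> on large indices. Multiplication by \<open>1 / a\<^sub>-\<close> and projection to
  nonnegative indices give \<open>a\<^sub>+ P = (1 / a\<^sub>-(1/w)) / (1 - w \<zeta>)\<close> up to a term controlled by \<open>R\<close> and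
  by \<open>|w|\<^sup>n\<close>; at \<open>\<zeta> = 1/z\<close> the main term is the limit kernel. Since the factors continue
  analytically across the circle, the coefficients of \<open>1 / a\<^sub>+\<close> decay geometrically, and this makes
  \<open>R\<close> as small as required.
\<close>

section \<open>Means over circles and Laurent coefficients\<close>

text \<open>The obstacle is uniformity in \<open>n\<close>. The solution vector depends on
  \<open>n\<close> and may be large, so its size must not enter the result. Fixed sequences are
  therefore measured in l1, unknown ones in the sup norm, and crude bounds on the unknowns serve
  only to make sums converge.

  The two variables play different roles. The point 1/z lies in the disc, where the plus factor has
  no zeros, so dividing by it is harmless. The point 1/w lies outside; once f_{-M,s}(1/w) has been
  split off, only the minus factor is evaluated there, and it is controlled up to infinity. The
  annulus on which both factors are known to be zero-free may be thinner than the one on which they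
  are analytic, and the thinner one fixes the decay rate \<open>\<sigma>\<close>.\<close>

definition circ_mean :: "real \<Rightarrow> (complex \<Rightarrow> complex) \<Rightarrow> complex" where
  "circ_mean \<rho> h = integral {-pi..pi} (\<lambda>\<theta>. h (of_real \<rho> * cis \<theta>)) / (2 * of_real pi)"

lemma circ_mean_cong:
  assumes "\<And>z. norm z = \<bar>\<rho>\<bar> \<Longrightarrow> g z = h z"
  shows "circ_mean \<rho> g = circ_mean \<rho> h"
  unfolding circ_mean_def
  by (intro arg_cong2[where f = "(/)"] integral_cong assms) (auto simp: norm_mult)

lemma continuous_on_circle:
  assumes "continuous_on {z. norm z = \<bar>\<rho>\<bar>} h"
  shows "continuous_on A (\<lambda>\<theta>. h (of_real \<rho> * cis \<theta>))"
  by (rule continuous_on_compose2[OF assms]) (auto intro!: continuous_intros simp: norm_mult)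

lemma integrable_circle:
  fixes h :: "complex \<Rightarrow> complex"
  assumes "continuous_on {z. norm z = \<bar>\<rho>\<bar>} h"
  shows "(\<lambda>\<theta>. h (of_real \<rho> * cis \<theta>)) integrable_on {-pi..pi}"
  by (intro integrable_continuous_real continuous_on_circle assms)

lemma circ_mean_diff:
  assumes "continuous_on {z. norm z = \<bar>\<rho>\<bar>} g" "continuous_on {z. norm z = \<bar>\<rho>\<bar>} h"
  shows "circ_mean \<rho> (\<lambda>z. g z - h z) = circ_mean \<rho> g - circ_mean \<rho> h"
  unfolding circ_mean_def
  by (simp add: integral_diff integrable_circle assms diff_divide_distrib)

lemma circ_mean_cmult: "circ_mean \<rho> (\<lambda>z. c * h z) = c * circ_mean \<rho> h"
  unfolding circ_mean_def by simp

lemma circ_mean_const: "circ_mean \<rho> (\<lambda>z. c) = c"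
  unfolding circ_mean_def by (simp add: scaleR_conv_of_real)

lemma norm_circ_mean_le:
  assumes "continuous_on {z. norm z = \<bar>\<rho>\<bar>} h" "\<And>z. norm z = \<bar>\<rho>\<bar> \<Longrightarrow> norm (h z) \<le> B"
  shows "norm (circ_mean \<rho> h) \<le> B"
proof -
  have "norm (integral {-pi..pi} (\<lambda>\<theta>. h (of_real \<rho> * cis \<theta>))) \<le> B * (pi - (-pi))"
    by (rule integral_bound) (auto intro!: continuous_on_circle assms simp: norm_mult)
  then show ?thesis
    unfolding circ_mean_def by (simp add: norm_divide norm_mult field_simps)
qed

lemma has_sum_circ_mean:
  assumes cont: "\<And>k. k \<in> I \<Longrightarrow> continuous_on {z. norm z = \<bar>\<rho>\<bar>} (g k)"
    and le: "\<And>k z. k \<in> I \<Longrightarrow> norm z = \<bar>\<rho>\<bar> \<Longrightarrow> norm (g k z) \<le> b k"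
    and b: "b summable_on I"
    and sm: "\<And>z. norm z = \<bar>\<rho>\<bar> \<Longrightarrow> ((\<lambda>k. g k z) has_sum h z) I"
  shows "((\<lambda>k. circ_mean \<rho> (g k)) has_sum circ_mean \<rho> h) I"
proof -
  let ?e = "\<lambda>\<theta>. complex_of_real \<rho> * cis \<theta>"
  have n: "norm (?e \<theta>) = \<bar>\<rho>\<bar>" for \<theta> by (simp add: norm_mult)
  \<comment> \<open>Termwise integration asks for continuity at every finite \<open>X\<close>, also
    outside \<open>I\<close>; terms off \<open>I\<close> are therefore set to 0.\<close>
  have u: "uniform_limit {-pi..pi} (\<lambda>X \<theta>. \<Sum>k\<in>X. if k \<in> I then g k (?e \<theta>) else 0)
      (\<lambda>\<theta>. \<Sum>\<^sub>\<infinity>k\<in>I. if k \<in> I then g k (?e \<theta>) else 0) (finite_subsets_at_top I)"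
    by (rule Weierstrass_m_test_general[where M = b]) (use le b n in auto)
  obtain J K where J: "\<And>X. ((\<lambda>\<theta>. \<Sum>k\<in>X. if k \<in> I then g k (?e \<theta>) else 0) has_integral J X) {-pi..pi}"
    and K: "((\<lambda>\<theta>. \<Sum>\<^sub>\<infinity>k\<in>I. if k \<in> I then g k (?e \<theta>) else 0) has_integral K) {-pi..pi}"
    and lim: "(J \<longlongrightarrow> K) (finite_subsets_at_top I)"
  proof (rule uniform_limit_integral[OF u])
    fix X show "continuous_on {-pi..pi} (\<lambda>\<theta>. \<Sum>k\<in>X. if k \<in> I then g k (?e \<theta>) else 0)"
    proof (rule continuous_on_sum)
      fix k assume "k \<in> X"
      show "continuous_on {- pi..pi} (\<lambda>\<theta>. if k \<in> I then g k (?e \<theta>) else 0)"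
        by (cases "k \<in> I") (auto intro!: continuous_on_circle cont)
    qed
  qed auto
  have hK: "(\<Sum>\<^sub>\<infinity>k\<in>I. if k \<in> I then g k (?e \<theta>) else 0) = h (?e \<theta>)" for \<theta>
    using infsumI[OF sm[OF n]] by (simp cong: infsum_cong)
  have K': "circ_mean \<rho> h = K / (2 * of_real pi)"
    unfolding circ_mean_def using integral_unique[OF K] hK by simp
  have J': "J X / (2 * of_real pi) = (\<Sum>k\<in>X. circ_mean \<rho> (g k))" if X: "finite X" "X \<subseteq> I" for X
  proof -
    have "J X = integral {-pi..pi} (\<lambda>\<theta>. \<Sum>k\<in>X. g k (?e \<theta>))"
      unfolding integral_unique[OF J[of X], symmetric]
      by (intro integral_cong sum.cong) (use X in auto)
    also have "\<dots> = (\<Sum>k\<in>X. integral {-pi..pi} (\<lambda>\<theta>. g k (?e \<theta>)))"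
      by (rule integral_sum) (use X in \<open>auto intro!: integrable_circle cont\<close>)
    finally show ?thesis by (simp add: circ_mean_def sum_divide_distrib)
  qed
  have "((\<lambda>X. J X / (2 * of_real pi)) \<longlongrightarrow> circ_mean \<rho> h) (finite_subsets_at_top I)"
    unfolding K' by (intro tendsto_intros lim) auto
  then show ?thesis
    unfolding has_sum_def
    by (rule Lim_transform_eventually)
      (auto intro!: eventually_finite_subsets_at_top_weakI simp: J')
qed

lemma open_annulus: "open {z::complex. r1 < norm z \<and> norm z < r2}"
  by (intro open_Collect_conj open_Collect_less continuous_intros)

text \<open>
  In the coordinate \<open>u = ln z\<close> the annulus becomes a convex strip, on which \<open>h (exp u)\<close> has a
  primitive \<open>F\<close>. By periodicity \<open>F (u + \<i>\<pi>) - F (u - \<i>\<pi>)\<close> has derivative zero.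
\<close>

lemma circ_mean_eq:
  assumes holo: "h holomorphic_on {z. r1 < norm z \<and> norm z < r2}"
    and "0 < \<rho>" "r1 < \<rho>" "\<rho> < r2" and "0 < \<sigma>" "r1 < \<sigma>" "\<sigma> < r2"
  shows "circ_mean \<rho> h = circ_mean \<sigma> h"
proof -
  define S where "S = {u. r1 < exp (Re u) \<and> exp (Re u) < r2}"
  have "open S" unfolding S_def
    by (intro open_Collect_conj open_Collect_less continuous_intros)
  have "is_interval {x::real. r1 < exp x \<and> exp x < r2}"
    unfolding is_interval_1 by (smt (verit) exp_le_cancel_iff mem_Collect_eq)
  then have "convex (Re -` {x. r1 < exp x \<and> exp x < r2})"
    by (intro convex_linear_vimage) (auto simp: is_interval_convex_1 bounded_linear.linear[OF bounded_linear_Re])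
  then have "convex S" unfolding S_def vimage_def by simp
  have "(\<lambda>u. h (exp u)) holomorphic_on S"
    by (rule holomorphic_on_compose_gen[OF holomorphic_on_exp holo, unfolded o_def])
       (auto simp: S_def)
  then obtain F where F: "\<And>u. u \<in> S \<Longrightarrow> (F has_field_derivative h (exp u)) (at u within S)"
    using holomorphic_convex_primitive'[OF \<open>convex S\<close> \<open>open S\<close>] by blast
  then have F': "(F has_field_derivative h (exp u)) (at u)" if "u \<in> S" for u
    using that \<open>open S\<close> by (metis at_within_open)
  have S_shift: "u + \<i> * of_real x \<in> S \<longleftrightarrow> u \<in> S" for u x by (simp add: S_def)
  have "((\<lambda>u. F (u + \<i> * of_real pi) - F (u - \<i> * of_real pi)) has_field_derivative 0) (at u within S)"
    if u: "u \<in> S" for u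
  proof -
    have "u + \<i> * of_real pi \<in> S" "u - \<i> * of_real pi \<in> S"
      using S_shift[of u pi] S_shift[of u "-pi"] u by auto
    note F1 = F'[OF this(1)] and F2 = F'[OF this(2)]
    have e: "exp (u + \<i> * of_real pi) = - exp u" "exp (u - \<i> * of_real pi) = - exp u"
      by (auto simp: exp_add exp_diff)
    have "((\<lambda>u. F (u + \<i> * of_real pi) - F (u - \<i> * of_real pi)) has_field_derivative
       h (exp (u + \<i> * of_real pi)) * 1 - h (exp (u - \<i> * of_real pi)) * 1) (at u)"
      by (intro DERIV_diff DERIV_chain2[where f = F and g = "\<lambda>u. u + \<i> * of_real pi"]
          DERIV_chain2[where f = F and g = "\<lambda>u. u - \<i> * of_real pi"] F1 F2)
        (auto intro!: derivative_eq_intros)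
    then show ?thesis unfolding e using has_field_derivative_at_within by force
  qed
  then obtain c where c: "\<And>u. u \<in> S \<Longrightarrow> F (u + \<i> * of_real pi) - F (u - \<i> * of_real pi) = c"
    using has_field_derivative_zero_constant[OF \<open>convex S\<close>,
        of "\<lambda>u. F (u + \<i> * of_real pi) - F (u - \<i> * of_real pi)"] by auto
  have "circ_mean r h = c / \<i> / (2 * of_real pi)" if r: "0 < r" "r1 < r" "r < r2" for r
  proof -
    \<comment> \<open>The circle of radius \<open>r\<close> is the image of the vertical segment
      from \<open>l - \<i> * of_real pi\<close> to \<open>l + \<i> * of_real pi\<close>; the
      increment of \<open>F\<close> along it is \<open>c\<close>, whatever \<open>r\<close>
      is.\<close>
    define l where "l = complex_of_real (ln r)"
    have lS: "l + \<i> * of_real \<theta> \<in> S" for \<theta> using r by (simp add: S_def l_def)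
    have el: "exp (l + \<i> * of_real \<theta>) = of_real r * cis \<theta>" for \<theta>
      using r by (simp add: exp_add l_def cis_conv_exp exp_of_real)
    have "((\<lambda>\<theta>. \<i> * h (of_real r * cis \<theta>)) has_integral
        F (l + \<i> * of_real pi) - F (l + \<i> * of_real (- pi))) {-pi..pi}"
    proof (rule fundamental_theorem_of_calculus)
      fix \<theta> :: real
      have "((\<lambda>x. l + \<i> * of_real x) has_vector_derivative \<i>) (at \<theta> within {-pi..pi})"
        by (auto intro!: derivative_eq_intros)
      from field_vector_diff_chain_within[OF this] F'[OF lS]
      have "(F \<circ> (\<lambda>x. l + \<i> * of_real x) has_vector_derivative \<i> * h (exp (l + \<i> * of_real \<theta>)))
        (at \<theta> within {-pi..pi})"
        by (meson DERIV_subset has_field_derivative_at_within)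
      then show "((\<lambda>\<theta>. F (l + \<i> * of_real \<theta>)) has_vector_derivative \<i> * h (of_real r * cis \<theta>))
        (at \<theta> within {-pi..pi})"
        by (simp add: el o_def)
    qed auto
    then have "((\<lambda>\<theta>. \<i> * h (of_real r * cis \<theta>)) has_integral c) {-pi..pi}"
      using c[of l] lS[of 0] by simp
    then have "integral {-pi..pi} (\<lambda>\<theta>. \<i> * h (of_real r * cis \<theta>)) = c"
      by (rule integral_unique)
    then have "\<i> * integral {-pi..pi} (\<lambda>\<theta>. h (of_real r * cis \<theta>)) = c" by simp
    then show ?thesis unfolding circ_mean_def by (metis complex_i_not_zero nonzero_mult_div_cancel_left)
  qed
  then show ?thesis using assms by simp
qed

section \<open>Fourier coefficients: Cauchy estimates, Laurent expansion, products\<close>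

lemma fourier_coeff_conv_circ_mean:
  "fourier_coeff h k = circ_mean 1 (\<lambda>z. h z * z powi (- k))"
  unfolding fourier_coeff_def circ_mean_def by (simp add: cis_power_int)

lemma fourier_coeff_cong:
  assumes "\<And>z. norm z = 1 \<Longrightarrow> g z = h z"
  shows "fourier_coeff g k = fourier_coeff h k"
  unfolding fourier_coeff_conv_circ_mean by (rule circ_mean_cong) (use assms in simp)

lemma holomorphic_on_powi:
  assumes "g holomorphic_on A" "0 \<notin> g ` A"
  shows "(\<lambda>z. g z powi k) holomorphic_on A"
  using assms by (auto intro!: holomorphic_intros simp: image_iff)

lemma fourier_coeff_eq_circ_mean:
  assumes holo: "h holomorphic_on {z. r1 < norm z \<and> norm z < r2}"
    and "r1 < 1" "1 < r2" and "0 < \<sigma>" "r1 < \<sigma>" "\<sigma> < r2"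
  shows "fourier_coeff h k = circ_mean \<sigma> (\<lambda>z. h z * z powi (- k))"
  unfolding fourier_coeff_conv_circ_mean
proof (rule circ_mean_eq)
  \<comment> \<open>A negative \<open>r1\<close> lets a disc count as an annulus; the power of
    \<open>z\<close> then forces the origin out.\<close>
  show "(\<lambda>z. h z * z powi (- k)) holomorphic_on {z. max r1 0 < norm z \<and> norm z < r2}"
    by (intro holomorphic_on_mult holomorphic_on_powi holomorphic_on_subset[OF holo]) auto
qed (use assms in auto)

text \<open>Cauchy's estimate. The radius is free: \<open>\<sigma> > 1\<close> gives geometric decay
  at +infinity, \<open>\<sigma> < 1\<close> at -infinity.\<close>

lemma norm_fourier_coeff_le:
  assumes holo: "h holomorphic_on {z. r1 < norm z \<and> norm z < r2}"
    and "r1 < 1" "1 < r2" and \<sigma>: "0 < \<sigma>" "r1 < \<sigma>" "\<sigma> < r2"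
    and B: "\<And>z. norm z = \<sigma> \<Longrightarrow> norm (h z) \<le> B"
  shows "norm (fourier_coeff h k) \<le> B * \<sigma> powi (- k)"
  unfolding fourier_coeff_eq_circ_mean[OF assms(1-6)]
proof (rule norm_circ_mean_le)
  show "continuous_on {z. norm z = \<bar>\<sigma>\<bar>} (\<lambda>z. h z * z powi (- k))"
    using \<sigma> by (intro holomorphic_on_imp_continuous_on holomorphic_on_mult holomorphic_on_powi
       holomorphic_on_subset[OF holo]) auto
  show "norm (h z * z powi (- k)) \<le> B * \<sigma> powi (- k)" if "norm z = \<bar>\<sigma>\<bar>" for z
    using that \<sigma> B[of z] by (simp add: norm_mult norm_power_int mult_right_mono)
qed

lemma holomorphic_bound_on_circle:
  assumes "h holomorphic_on {z. r1 < norm z \<and> norm z < r2}" "r1 < \<sigma>" "\<sigma> < r2"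
  obtains B where "B \<ge> 0" "\<And>z. norm z = \<sigma> \<Longrightarrow> norm (h z) \<le> B"
proof -
  have "compact {z::complex. norm z = \<sigma>}"
    using compact_sphere[of "0::complex" \<sigma>] by (simp add: sphere_def dist_norm norm_minus_commute)
  moreover have "continuous_on {z. norm z = \<sigma>} h"
    by (rule continuous_on_subset[OF holomorphic_on_imp_continuous_on[OF assms(1)]]) (use assms in auto)
  ultimately have "bounded (h ` {z. norm z = \<sigma>})"
    by (intro compact_imp_bounded compact_continuous_image)
  then obtain B where "B > 0" "\<forall>x\<in>h ` {z. norm z = \<sigma>}. norm x \<le> B"
    by (auto simp: bounded_pos)
  then show ?thesis by (intro that[of B]) auto
qed

lemma has_sum_int_split:
  fixes g :: "int \<Rightarrow> 'a::topological_ab_group_add"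
  assumes "((\<lambda>n. g (int n)) has_sum A) UNIV" "((\<lambda>n. g (- 1 - int n)) has_sum B) UNIV"
  shows "(g has_sum (A + B)) UNIV"
proof -
  have "(g has_sum A) (range int)"
    using assms(1) by (subst has_sum_reindex) (auto simp: o_def)
  moreover have "(g has_sum B) (range (\<lambda>n. - 1 - int n))"
    using assms(2) by (subst has_sum_reindex) (auto simp: o_def inj_on_def)
  moreover have "range int \<inter> range (\<lambda>n. - 1 - int n) = {}" by auto
  ultimately have "(g has_sum (A + B)) (range int \<union> range (\<lambda>n. - 1 - int n))"
    by (rule has_sum_Un_disjoint)
  moreover have "k \<in> range int \<union> range (\<lambda>n. - 1 - int n)" for k
  proof (cases "k \<ge> 0")
    case True then show ?thesis by (auto intro!: rev_image_eqI[of "nat k"])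
  next
    case False then show ?thesis by (auto intro!: rev_image_eqI[of "nat (- 1 - k)"])
  qed
  ultimately show ?thesis by (metis UNIV_eq_I)
qed

lemma summable_on_geometric:
  fixes x c :: real
  assumes "0 \<le> x" "x < 1"
  shows "(\<lambda>n. c * x ^ n) summable_on UNIV"
  using assms by (intro summable_on_cmult_right summable_nonneg_imp_summable_on summable_geometric) auto

text \<open>The Cauchy estimate is taken on a circle of radius \<open>s > norm w\<close> for
  nonnegative indices and \<open>t < norm w\<close> for negative ones; each half is dominated by a
  geometric series.\<close>

lemma fourier_coeff_summable:
  assumes holo: "h holomorphic_on {z. r1 < norm z \<and> norm z < r2}"
    and r: "r1 < 1" "1 < r2" and w: "w \<noteq> 0" "r1 < norm w" "norm w < r2"
  shows "(\<lambda>k. norm (fourier_coeff h k * w powi k)) summable_on UNIV"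
proof -
  obtain s where s: "norm w < s" "s < r2" using w dense by blast
  obtain t where t: "max r1 0 < t" "t < norm w" using w dense[of "max r1 0" "norm w"] by auto
  have s0: "0 < s" using le_less_trans[OF norm_ge_zero s(1)] .
  obtain B where B: "\<And>z. norm z = s \<Longrightarrow> norm (h z) \<le> B"
    using holomorphic_bound_on_circle[OF holo, of s] s w by auto
  obtain C where C: "\<And>z. norm z = t \<Longrightarrow> norm (h z) \<le> C"
    using holomorphic_bound_on_circle[OF holo, of t] t w by auto
  let ?g = "\<lambda>k. norm (fourier_coeff h k * w powi k)"
  have "(\<lambda>n. B * (norm w / s) ^ n) summable_on UNIV"
    using s s0 by (intro summable_on_geometric) auto
  then have 1: "(\<lambda>n. ?g (int n)) summable_on UNIV"
  proof (rule summable_on_comparison_test)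
    fix n
    have "norm (fourier_coeff h (int n)) \<le> B * s powi (- int n)"
      by (rule norm_fourier_coeff_le[OF holo]) (use r s s0 w B in auto)
    then have "norm (fourier_coeff h (int n)) * norm w ^ n \<le> B * s powi (- int n) * norm w ^ n"
      by (rule mult_right_mono) auto
    then show "?g (int n) \<le> B * (norm w / s) ^ n"
      using s0 by (simp add: norm_mult norm_power power_int_minus field_simps)
  qed auto
  have "(\<lambda>n. C * ((t / norm w) * (t / norm w) ^ n)) summable_on UNIV"
    using t w summable_on_geometric[of "t / norm w" "C * (t / norm w)"] by (simp add: mult.assoc)
  then have 2: "(\<lambda>n. ?g (- 1 - int n)) summable_on UNIV"
  proof (rule summable_on_comparison_test)
    fix n
    have e: "a powi (- 1 - int n) = inverse (a ^ Suc n)" for a :: "'a::field"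
      using power_int_minus[of a "int (Suc n)"] power_int_of_nat[of a "Suc n"] by (simp add: algebra_simps)
    have "norm (fourier_coeff h (- 1 - int n)) \<le> C * t powi (- (- 1 - int n))"
      by (rule norm_fourier_coeff_le[OF holo]) (use r t w C in auto)
    also have "t powi (- (- 1 - int n)) = t ^ Suc n"
      using power_int_of_nat[of t "Suc n"] by (simp add: algebra_simps)
    finally have "norm (fourier_coeff h (- 1 - int n)) * inverse (norm w ^ Suc n)
        \<le> C * t ^ Suc n * inverse (norm w ^ Suc n)"
      by (rule mult_right_mono) auto
    moreover have "?g (- 1 - int n) = norm (fourier_coeff h (- 1 - int n)) * inverse (norm w ^ Suc n)"
      by (simp only: e norm_mult norm_inverse norm_power)
    moreover have "C * t ^ Suc n * inverse (norm w ^ Suc n) = C * ((t / norm w) * (t / norm w) ^ n)"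
      by (simp add: power_mult_distrib power_inverse divide_inverse)
    ultimately show "?g (- 1 - int n) \<le> C * ((t / norm w) * (t / norm w) ^ n)" by simp
  qed auto
  show ?thesis
    using has_sum_int_split[OF has_sum_infsum[OF 1] has_sum_infsum[OF 2]] by (rule has_sum_imp_summable)
qed

lemma has_sum_geometric:
  fixes x :: "'a :: {real_normed_field, banach}"
  assumes "norm x < 1"
  shows "((\<lambda>n. x ^ n) has_sum (1 / (1 - x))) UNIV"
  by (rule norm_summable_imp_has_sum) (use assms geometric_sums in \<open>auto simp: norm_power\<close>)

text \<open>A mean over a circle integrates against dz/z, so \<open>z / (z - w)\<close> is the
  Cauchy kernel. Its expansion in \<open>w / z\<close> on the outer circle supplies the nonnegative
  indices, that in \<open>z / w\<close> on the inner circle the negative ones.\<close>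

lemma fourier_series_has_sum_mean:
  assumes holo: "h holomorphic_on {z. r1 < norm z \<and> norm z < r2}"
    and r: "r1 < 1" "1 < r2" and w: "w \<noteq> 0" 
    and s: "norm w < s" "r1 < s" "s < r2" and t: "0 < t" "r1 < t" "t < norm w" "t < r2"
  shows "((\<lambda>k. fourier_coeff h k * w powi k) has_sum
     (circ_mean s (\<lambda>z. h z * (z / (z - w))) - circ_mean t (\<lambda>z. h z * (z / (z - w))))) UNIV"
proof -
  have s0: "0 < s" using s by (meson le_less_trans norm_ge_zero)
  have contS: "continuous_on {z. norm z = \<bar>s\<bar>} h"
    by (rule continuous_on_subset[OF holomorphic_on_imp_continuous_on[OF holo]]) (use s s0 in auto)
  have contT: "continuous_on {z. norm z = \<bar>t\<bar>} h"
    by (rule continuous_on_subset[OF holomorphic_on_imp_continuous_on[OF holo]]) (use t in auto)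
  obtain B where B0: "B \<ge> 0" and B: "\<And>z. norm z = s \<Longrightarrow> norm (h z) \<le> B"
    using holomorphic_bound_on_circle[OF holo, of s] s by auto
  obtain C where C0: "C \<ge> 0" and C: "\<And>z. norm z = t \<Longrightarrow> norm (h z) \<le> C"
    using holomorphic_bound_on_circle[OF holo, of t] t by auto
  have "((\<lambda>n. circ_mean s (\<lambda>z. h z * (w / z) ^ n)) has_sum circ_mean s (\<lambda>z. h z * (z / (z - w)))) UNIV"
  proof (rule has_sum_circ_mean)
    show "continuous_on {z. norm z = \<bar>s\<bar>} (\<lambda>z. h z * (w / z) ^ n)" for n
      using s0 by (intro continuous_on_mult contS continuous_intros) auto
    show "norm (h z * (w / z) ^ n) \<le> B * (norm w / s) ^ n" if "norm z = \<bar>s\<bar>" for n z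
      using that s0 B[of z] by (auto simp: norm_mult norm_power norm_divide intro!: mult_right_mono)
    show "(\<lambda>n. B * (norm w / s) ^ n) summable_on UNIV"
      using s w s0 by (intro summable_on_geometric) auto
    show "((\<lambda>n. h z * (w / z) ^ n) has_sum h z * (z / (z - w))) UNIV" if "norm z = \<bar>s\<bar>" for z
    proof -
      have "z \<noteq> 0" "norm (w / z) < 1" "z \<noteq> w" using that s s0 by (auto simp: norm_divide)
      then show ?thesis
        using has_sum_cmult_right[OF has_sum_geometric[of "w / z"], of "h z"]
        by (simp add: field_simps)
    qed
  qed
  moreover have "circ_mean s (\<lambda>z. h z * (w / z) ^ n) = fourier_coeff h (int n) * w powi (int n)" for n
  proof -
    have "circ_mean s (\<lambda>z. h z * (w / z) ^ n) = circ_mean s (\<lambda>z. w ^ n * (h z * z powi (- int n)))"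
      by (rule circ_mean_cong) (simp add: power_int_minus power_divide field_simps)
    then show ?thesis
      using fourier_coeff_eq_circ_mean[OF holo r s0 s(2,3)] by (simp add: circ_mean_cmult mult.commute)
  qed
  ultimately have 1: "((\<lambda>n. fourier_coeff h (int n) * w powi (int n)) has_sum
      circ_mean s (\<lambda>z. h z * (z / (z - w)))) UNIV" by simp
  \<comment> \<open>On the inner circle the kernel is minus the sum of \<open>(z / w) ^ k\<close>
    over k at least 1; the extra factor \<open>z / w\<close> makes \<open>n\<close> stand for the
    index \<open>- 1 - n\<close>.\<close>
  have "((\<lambda>n. circ_mean t (\<lambda>z. h z * ((z / w) * (z / w) ^ n))) has_sum
      circ_mean t (\<lambda>z. (-1) * (h z * (z / (z - w))))) UNIV"
  proof (rule has_sum_circ_mean)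
    show "continuous_on {z. norm z = \<bar>t\<bar>} (\<lambda>z. h z * ((z / w) * (z / w) ^ n))" for n
      using w by (intro continuous_intros contT) auto
    show "norm (h z * ((z / w) * (z / w) ^ n)) \<le> C * ((t / norm w) * (t / norm w) ^ n)" 
      if "norm z = \<bar>t\<bar>" for n z
      using that t mult_right_mono[OF C[of z], of "norm ((z / w) * (z / w) ^ n)"]
      by (simp add: norm_mult norm_power norm_divide)
    show "(\<lambda>n. C * ((t / norm w) * (t / norm w) ^ n)) summable_on UNIV"
      using t w summable_on_geometric[of "t / norm w" "C * (t / norm w)"] by (simp add: mult.assoc)
    show "((\<lambda>n. h z * ((z / w) * (z / w) ^ n)) has_sum (-1) * (h z * (z / (z - w)))) UNIV" 
      if "norm z = \<bar>t\<bar>" for z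
    proof -
      have "norm (z / w) < 1" "z \<noteq> w" using that t w by (auto simp: norm_divide)
      moreover have "h z * (z / w) * (1 / (1 - z / w)) = (-1) * (h z * (z / (z - w)))"
        using w \<open>z \<noteq> w\<close> by (simp add: divide_simps) (simp add: algebra_simps)
      ultimately show ?thesis
        using has_sum_cmult_right[OF has_sum_geometric[of "z / w"], of "h z * (z / w)"]
        by (simp add: mult.assoc)
    qed
  qed
  moreover have "circ_mean t (\<lambda>z. h z * ((z / w) * (z / w) ^ n))
      = fourier_coeff h (- 1 - int n) * w powi (- 1 - int n)" for n
  proof -
    have e: "a powi (- 1 - int n) = inverse (a ^ Suc n)" "a powi (1 + int n) = a ^ Suc n" for a :: complex
      using power_int_minus[of a "int (Suc n)"] power_int_of_nat[of a "Suc n"]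
      by (simp_all add: algebra_simps)
    have "circ_mean t (\<lambda>z. h z * ((z / w) * (z / w) ^ n))
      = circ_mean t (\<lambda>z. w powi (- 1 - int n) * (h z * z powi (- (- 1 - int n))))"
      using w by (intro circ_mean_cong) (simp add: e power_divide field_simps)
    then show ?thesis
      using fourier_coeff_eq_circ_mean[OF holo r t(1,2,4)] by (simp add: circ_mean_cmult mult.commute)
  qed
  ultimately have 2: "((\<lambda>n. fourier_coeff h (- 1 - int n) * w powi (- 1 - int n)) has_sum
      - circ_mean t (\<lambda>z. h z * (z / (z - w)))) UNIV"
    by (simp only: circ_mean_cmult) simp
  from has_sum_int_split[where g = "\<lambda>k. fourier_coeff h k * w powi k", OF 1 2] show ?thesis by simp
qed

text \<open>Cauchy's estimate on circles shrinking to the origin, near which \<open>h\<close> stays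
  bounded.\<close>

lemma fourier_coeff_neg_eq_0:
  assumes holo: "h holomorphic_on {z. norm z < r}" and "1 < r" "k < 0"
  shows "fourier_coeff h k = 0"
proof (rule ccontr)
  assume nz: "fourier_coeff h k \<noteq> 0"
  define x where "x = norm (fourier_coeff h k)"
  have x: "x > 0" using nz by (simp add: x_def)
  have "compact (cball (0::complex) 1)" by simp
  moreover have "continuous_on (cball 0 1) h"
    by (rule continuous_on_subset[OF holomorphic_on_imp_continuous_on[OF holo]]) (use assms in auto)
  ultimately have "bounded (h ` cball 0 1)" by (intro compact_imp_bounded compact_continuous_image)
  then obtain B where B: "B > 0" "\<And>z. norm z \<le> 1 \<Longrightarrow> norm (h z) \<le> B"
    by (auto simp: bounded_pos)
  \<comment> \<open>Small enough for \<open>B * s < x\<close>, against the estimate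
    \<open>x \<le> B * s\<close>.\<close>
  define s where "s = x / (x + B + 1)"
  have s: "0 < s" "s < 1" using x B by (auto simp: s_def)
  have "x \<le> B * s powi (- k)" unfolding x_def
    by (rule norm_fourier_coeff_le[where ?r1.0 = "-1" and ?r2.0 = r])
      (use s assms B in \<open>auto intro: holomorphic_on_subset[OF holo]\<close>)
  also have "s powi (- k) = s * s ^ (nat (- k) - 1)"
    using \<open>k < 0\<close> power_Suc[of s "nat (- k) - 1"] by (simp add: power_int_def del: power_Suc)
  also have "\<dots> \<le> s * 1" using s by (intro mult_left_mono power_le_one) auto
  finally have "x \<le> B * s" using B by (simp add: mult_left_mono)
  moreover have "x * B < x * (x + B + 1)" using x by (intro mult_strict_left_mono) auto
  then have "B * s < x" using x B by (simp add: s_def pos_divide_less_eq mult.commute)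
  ultimately show False by simp
qed

text \<open>Cauchy's estimate on a large circle: the limit bounds \<open>h\<close> near infinity by
  \<open>B\<close>, and a radius beyond \<open>B / x\<close> gives the contradiction.\<close>

lemma fourier_coeff_pos_eq_0:
  assumes holo: "h holomorphic_on {z. r < norm z}" and "r < 1" "k > 0"
    and lim: "(h \<longlongrightarrow> L) at_infinity"
  shows "fourier_coeff h k = 0"
proof (rule ccontr)
  assume nz: "fourier_coeff h k \<noteq> 0"
  define x where "x = norm (fourier_coeff h k)"
  have x: "x > 0" using nz by (simp add: x_def)
  define B where "B = norm L + 1"
  have "eventually (\<lambda>z. norm (h z) < B) at_infinity"
    using tendsto_norm[OF lim] by (rule order_tendstoD) (simp add: B_def)
  then obtain R where R: "\<And>z. norm z \<ge> R \<Longrightarrow> norm (h z) < B"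
    by (auto simp: eventually_at_infinity)
  have B: "B > 0" by (simp add: B_def add_nonneg_pos)
  define s where "s = max (max R 1) (B / x + 1)"
  have s: "s \<ge> R" "s \<ge> 1" "s > B / x" by (auto simp: s_def)
  have "x \<le> B * s powi (- k)" unfolding x_def
    by (rule norm_fourier_coeff_le[where ?r1.0 = r and ?r2.0 = "s + 1"])
      (use s assms R in \<open>auto intro: holomorphic_on_subset[OF holo] less_imp_le\<close>)
  also have "s powi (- k) \<le> s powi (-1)"
    by (rule power_int_increasing) (use s \<open>k > 0\<close> in auto)
  finally have "x \<le> B * inverse s" using B by (simp add: mult_left_mono power_int_minus)
  moreover have "B * inverse s < x" using x B s by (simp add: field_simps)
  ultimately show False by simp
qed

lemma fourier_coeff_1: "fourier_coeff (\<lambda>z. 1) k = (if k = 0 then 1 else 0)"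
proof -
  consider "k < 0" | "k = 0" | "k > 0" by linarith
  then show ?thesis
  proof cases
    case 1 then show ?thesis
      using fourier_coeff_neg_eq_0[of "\<lambda>z. 1" 2 k] by (auto intro!: holomorphic_intros)
  next
    case 2 then show ?thesis by (simp add: fourier_coeff_conv_circ_mean circ_mean_const)
  next
    case 3 then show ?thesis
      using fourier_coeff_pos_eq_0[of "\<lambda>z. 1" 0 k 1] by (auto intro!: holomorphic_intros)
  qed
qed

text \<open>Cauchy's formula by removing the singularity: \<open>q\<close> is holomorphic across
  \<open>w\<close>, so the means of \<open>z * q z\<close> over both circles agree. The difference
  of the Cauchy means of \<open>h\<close> is thus \<open>h w\<close> times that of the constant
  1.\<close>

lemma laurent_has_sum:
  assumes holo: "h holomorphic_on {z. r1 < norm z \<and> norm z < r2}"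
    and r: "r1 < 1" "1 < r2" and w: "w \<noteq> 0" "r1 < norm w" "norm w < r2"
  shows "((\<lambda>k. fourier_coeff h k * w powi k) has_sum h w) UNIV"
proof -
  obtain s where s: "norm w < s" "s < r2" using w dense by blast
  obtain t where t: "max r1 0 < t" "t < norm w" using w dense[of "max r1 0" "norm w"] by auto
  have s0: "0 < s" "r1 < s" using s w by (auto intro: le_less_trans[OF norm_ge_zero])
  have t0: "0 < t" "r1 < t" "t < r2" using t w by auto
  let ?A = "{z. r1 < norm z \<and> norm z < r2}"
  define q where "q = (\<lambda>z. if z = w then deriv h w else h z / (z - w) - h w / (z - w))"
  have q: "q holomorphic_on ?A" unfolding q_def
    by (rule pole_theorem_open[OF holo open_annulus]) auto
  have cont: "continuous_on {z. norm z = \<bar>x\<bar>} h" if "r1 < x" "x < r2" "0 < x" for x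
    by (rule continuous_on_subset[OF holomorphic_on_imp_continuous_on[OF holo]]) (use that in auto)
  have q_mean: "circ_mean x (\<lambda>z. z * q z) =
      circ_mean x (\<lambda>z. h z * (z / (z - w))) - h w * circ_mean x (\<lambda>z. 1 * (z / (z - w)))"
    if x: "r1 < x" "x < r2" "0 < x" "norm w \<noteq> x" for x
  proof -
    have "circ_mean x (\<lambda>z. z * q z) = circ_mean x (\<lambda>z. h z * (z / (z - w)) - h w * (z / (z - w)))"
      by (rule circ_mean_cong) (use x in \<open>auto simp: q_def algebra_simps\<close>)
    also have "\<dots> = circ_mean x (\<lambda>z. h z * (z / (z - w))) - circ_mean x (\<lambda>z. h w * (z / (z - w)))"
      using x by (intro circ_mean_diff continuous_intros cont) auto
    finally show ?thesis unfolding circ_mean_cmult by simp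
  qed
  have eq: "circ_mean s (\<lambda>z. z * q z) = circ_mean t (\<lambda>z. z * q z)"
    by (rule circ_mean_eq[of _ r1 r2]) (use s s0 t t0 in \<open>auto intro!: holomorphic_intros q\<close>)
  \<comment> \<open>The normalisation is read off from the series of the constant function, whose
    coefficients are known; no residue is computed.\<close>
  have one: "circ_mean s (\<lambda>z. 1 * (z / (z - w))) - circ_mean t (\<lambda>z. 1 * (z / (z - w))) = 1"
  proof -
    have "((\<lambda>k. fourier_coeff (\<lambda>z. 1) k * w powi k) has_sum
      (circ_mean s (\<lambda>z. 1 * (z / (z - w))) - circ_mean t (\<lambda>z. 1 * (z / (z - w))))) UNIV"
      by (rule fourier_series_has_sum_mean[of _ r1 r2])
        (use s s0 t t0 r w in \<open>auto intro!: holomorphic_intros\<close>)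
    moreover have "((\<lambda>k. fourier_coeff (\<lambda>z. 1) k * w powi k) has_sum 1) UNIV"
      by (subst has_sum_cong_neutral[where T = "{0}" and g = "\<lambda>k. 1"])
        (auto simp: fourier_coeff_1 intro!: has_sum_finiteI)
    ultimately show ?thesis by (rule has_sum_unique)
  qed
  have "circ_mean s (\<lambda>z. h z * (z / (z - w))) - circ_mean t (\<lambda>z. h z * (z / (z - w)))
      = h w * (circ_mean s (\<lambda>z. 1 * (z / (z - w))) - circ_mean t (\<lambda>z. 1 * (z / (z - w))))"
    using eq q_mean[of s] q_mean[of t] s s0 t t0 by (simp add: algebra_simps)
  also have "\<dots> = h w" unfolding one by simp
  finally show ?thesis
    using fourier_series_has_sum_mean[OF holo r w(1) s(1) s0(2) s(2) t0(1,2) t(2) t0(3)] by simp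
qed

text \<open>Only \<open>g\<close> is expanded: its series converges absolutely on the circle and is
  integrated termwise against \<open>h\<close>, for which continuity suffices.\<close>

lemma fourier_coeff_mult:
  assumes g: "g holomorphic_on {z. r1 < norm z \<and> norm z < r2}" "r1 < 1" "1 < r2"
    and h: "continuous_on {z. norm z = 1} h"
  shows "((\<lambda>l. fourier_coeff g l * fourier_coeff h (k - l)) has_sum
    fourier_coeff (\<lambda>z. g z * h z) k) UNIV"
proof -
  have "compact {z::complex. norm z = 1}"
    using compact_sphere[of "0::complex" 1] by (simp add: sphere_def dist_norm norm_minus_commute)
  then have "bounded (h ` {z. norm z = 1})"
    by (intro compact_imp_bounded compact_continuous_image h)
  then obtain B where B: "B > 0" "\<And>z. norm z = 1 \<Longrightarrow> norm (h z) \<le> B"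
    by (auto simp: bounded_pos)
  have "((\<lambda>l. circ_mean 1 (\<lambda>z. fourier_coeff g l * (z powi l * h z * z powi (- k)))) has_sum
    circ_mean 1 (\<lambda>z. g z * h z * z powi (- k))) UNIV"
  proof (rule has_sum_circ_mean)
    show "continuous_on {z. norm z = \<bar>1\<bar>} (\<lambda>z. fourier_coeff g l * (z powi l * h z * z powi (- k)))" for l
      using h by (auto intro!: continuous_intros)
    show "norm (fourier_coeff g l * (z powi l * h z * z powi (- k)))
        \<le> norm (fourier_coeff g l * 1 powi l) * B" if "norm z = \<bar>1\<bar>" for l z
      using that B(2)[of z] by (auto simp: norm_mult norm_power_int intro!: mult_left_mono)
    show "(\<lambda>l. norm (fourier_coeff g l * 1 powi l) * B) summable_on UNIV"
      by (intro summable_on_cmult_left fourier_coeff_summable[OF g]) (use g in auto)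
    show "((\<lambda>l. fourier_coeff g l * (z powi l * h z * z powi (- k))) has_sum
      g z * h z * z powi (- k)) UNIV" if "norm z = \<bar>1\<bar>" for z
    proof -
      have "z \<noteq> 0" using that by auto
      then show ?thesis
        using has_sum_cmult_left[OF laurent_has_sum[OF g, of z], of "h z * z powi (- k)"] that g
        by (simp add: mult.assoc)
    qed
  qed
  moreover have "circ_mean 1 (\<lambda>z. z powi l * h z * z powi (- k)) = fourier_coeff h (k - l)" for l
    unfolding fourier_coeff_conv_circ_mean
  proof (rule circ_mean_cong)
    fix z :: complex assume "norm z = \<bar>1\<bar>"
    then have "z \<noteq> 0" by auto
    then show "z powi l * h z * z powi (- k) = h z * z powi (- (k - l))"
      using power_int_add[of z l "-k"] by (simp add: algebra_simps)
  qed
  ultimately show ?thesis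
    unfolding circ_mean_cmult by (simp add: fourier_coeff_conv_circ_mean[of "\<lambda>z. g z * h z"])
qed

section \<open>Convolution of coefficient sequences\<close>

lemma infsum_norm_bound:
  fixes f :: "'a \<Rightarrow> complex"
  assumes "g summable_on A" "\<And>x. x \<in> A \<Longrightarrow> norm (f x) \<le> g x"
  shows "f summable_on A" "norm (infsum f A) \<le> infsum g A"
proof -
  have 1: "(\<lambda>x. norm (f x)) summable_on A"
    by (rule summable_on_comparison_test[OF assms(1)]) (use assms in auto)
  then show "f summable_on A" by (rule abs_summable_summable)
  have "norm (infsum f A) \<le> infsum (\<lambda>x. norm (f x)) A" by (rule norm_infsum_bound[OF 1])
  also have "\<dots> \<le> infsum g A" by (rule infsum_mono[OF 1 assms(1)]) (use assms in auto)
  finally show "norm (infsum f A) \<le> infsum g A" .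
qed

lemma has_sum_sum:
  fixes f :: "'i \<Rightarrow> 'a \<Rightarrow> 'b::topological_comm_monoid_add"
  assumes "\<And>i. i \<in> I \<Longrightarrow> (f i has_sum s i) A"
  shows "((\<lambda>x. \<Sum>i\<in>I. f i x) has_sum (\<Sum>i\<in>I. s i)) A"
  using assms by (induction I rule: infinite_finite_induct) (auto intro!: has_sum_add)

lemma has_sum_diff:
  fixes f g :: "'a \<Rightarrow> 'b::topological_ab_group_add"
  assumes "(f has_sum x) A" "(g has_sum y) A"
  shows "((\<lambda>k. f k - g k) has_sum (x - y)) A"
  using has_sum_add[OF assms(1), of "\<lambda>k. - g k" "- y"] assms(2) by (simp add: has_sum_uminus)

text \<open>Defined as 0 where the sum diverges. The first argument will be absolutely summable and
  the second bounded.\<close>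

definition conv :: "(int \<Rightarrow> complex) \<Rightarrow> (int \<Rightarrow> complex) \<Rightarrow> int \<Rightarrow> complex" where
  "conv x v k = (\<Sum>\<^sub>\<infinity>l. x l * v (k - l))"

definition norm1 :: "(int \<Rightarrow> complex) \<Rightarrow> real" where
  "norm1 x = (\<Sum>\<^sub>\<infinity>l. norm (x l))"

lemma norm1_nonneg: "norm1 x \<ge> 0"
  unfolding norm1_def by (rule infsum_nonneg) auto

lemma conv_bound:
  assumes x: "(\<lambda>l. norm (x l)) summable_on UNIV"
    and v: "\<And>l. norm (v l) \<le> B"
  shows "(\<lambda>l. x l * v (k - l)) summable_on UNIV" "norm (conv x v k) \<le> norm1 x * B"
proof -
  have "norm (x l * v (k - l)) \<le> norm (x l) * B" for l
    using v[of "k - l"] by (simp add: norm_mult mult_left_mono)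
  note * = infsum_norm_bound[where g = "\<lambda>l. norm (x l) * B", OF summable_on_cmult_left[OF x] this]
  show "(\<lambda>l. x l * v (k - l)) summable_on UNIV" by (rule *)
  show "norm (conv x v k) \<le> norm1 x * B"
    using *(2) infsum_cmult_left[where c = B and f = "\<lambda>l. norm (x l)"] x
    unfolding conv_def norm1_def by simp
qed

lemma conv_add:
  assumes x: "(\<lambda>l. norm (x l)) summable_on UNIV"
    and "\<And>l. norm (u l) \<le> A" "\<And>l. norm (v l) \<le> B"
  shows "conv x (\<lambda>l. u l + v l) k = conv x u k + conv x v k"
  unfolding conv_def distrib_left
  by (intro infsum_add conv_bound(1)[OF x assms(2)] conv_bound(1)[OF x assms(3)])

text \<open>Associativity with a finitely supported factor \<open>P\<close>: the product of
  \<open>a\<close> and \<open>P\<close> is a finite combination of shifts of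
  \<open>a\<close>.\<close>

lemma conv_finite_sum:
  assumes x: "(\<lambda>l. norm (x l)) summable_on UNIV" and a: "\<And>l. norm (a l) \<le> B"
  shows "conv x (\<lambda>k. \<Sum>i<n. a (k - int i) * P i) k = (\<Sum>i<(n::nat). conv x a (k - int i) * P i)"
proof -
  have "conv x (\<lambda>k. \<Sum>i<n. a (k - int i) * P i) k =
      (\<Sum>\<^sub>\<infinity>l. \<Sum>i<n. x l * a ((k - int i) - l) * P i)"
    unfolding conv_def by (simp add: sum_distrib_left algebra_simps)
  also have "\<dots> = (\<Sum>i<n. \<Sum>\<^sub>\<infinity>l. x l * a ((k - int i) - l) * P i)"
    by (intro infsumI has_sum_sum has_sum_infsum summable_on_cmult_left conv_bound(1)[OF x a])
  also have "\<dots> = (\<Sum>i<n. conv x a (k - int i) * P i)"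
    unfolding conv_def
    by (intro sum.cong refl infsum_cmult_left conv_bound[OF x a])
  finally show ?thesis .
qed

text \<open>Associativity by Fubini: the double series is dominated by
  \<open>norm (x j) * norm (y l) * B\<close> and is reordered by \<open>t = l + j\<close>, which
  makes \<open>conv x y\<close>, the unit sequence, appear inside.\<close>

lemma conv_inverse:
  assumes x: "(\<lambda>l. norm (x l)) summable_on UNIV" and y: "(\<lambda>l. norm (y l)) summable_on UNIV"
    and v: "\<And>l. norm (v l) \<le> B" and inv: "\<And>k. conv x y k = (if k = 0 then 1 else 0)"
  shows "conv x (conv y v) k = v k"
proof -
  have B: "B \<ge> 0" using v[of 0] norm_ge_zero by (rule order_trans[rotated])
  have s: "(\<lambda>(j, l). norm (x j) * norm (y l) * B) summable_on UNIV \<times> UNIV"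
  proof (rule summable_on_SigmaI)
    show "((\<lambda>l. case (j, l) of (j, l) \<Rightarrow> norm (x j) * norm (y l) * B) has_sum (norm (x j) * norm1 y * B)) UNIV" for j
      unfolding norm1_def prod.case
      by (intro has_sum_cmult_left has_sum_cmult_right has_sum_infsum y)
    show "(\<lambda>j. norm (x j) * norm1 y * B) summable_on UNIV"
      by (intro summable_on_cmult_left x)
  qed (use B in auto)
  have s': "(\<lambda>(j, l). x j * y l * v (k - j - l)) summable_on UNIV \<times> UNIV"
    by (rule infsum_norm_bound(1)[OF s]) (auto simp: norm_mult v intro!: mult_left_mono)
  have bij: "(\<lambda>(j, t). x j * y (t - j) * v (k - t)) summable_on UNIV \<times> UNIV"
    by (subst summable_on_reindex_bij_witness[where i = "\<lambda>(j, l). (j, l + j)"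
          and j = "\<lambda>(j, t). (j, t - j)" and T = "UNIV \<times> UNIV" and h = "\<lambda>(j, l). x j * y l * v (k - j - l)"])
      (use s' in auto)
  have "conv x (conv y v) k = (\<Sum>\<^sub>\<infinity>j. \<Sum>\<^sub>\<infinity>l. x j * (y l * v (k - j - l)))"
    unfolding conv_def by (simp add: infsum_cmult_right' )
  also have "\<dots> = (\<Sum>\<^sub>\<infinity>j. \<Sum>\<^sub>\<infinity>t. x j * y (t - j) * v (k - t))"
  proof (rule infsum_cong)
    fix j
    show "(\<Sum>\<^sub>\<infinity>l. x j * (y l * v (k - j - l))) = (\<Sum>\<^sub>\<infinity>t. x j * y (t - j) * v (k - t))"
      by (rule infsum_reindex_bij_witness[where i = "\<lambda>t. t - j" and j = "\<lambda>l. l + j"])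
        (auto simp: algebra_simps)
  qed
  also have "\<dots> = (\<Sum>\<^sub>\<infinity>t. \<Sum>\<^sub>\<infinity>j. x j * y (t - j) * v (k - t))"
    by (rule infsum_swap_banach[OF bij])
  also have "\<dots> = (\<Sum>\<^sub>\<infinity>t. conv x y t * v (k - t))"
    unfolding conv_def by (simp add: infsum_cmult_left')
  also have "\<dots> = (\<Sum>\<^sub>\<infinity>t\<in>{0::int}. v k)"
    by (rule infsum_cong_neutral) (auto simp: inv)
  finally show ?thesis by simp
qed

text \<open>\<open>B\<close> secures convergence but is absent from the result, so a bound on
  \<open>v\<close> that depends on \<open>n\<close> may be used for it.\<close>

lemma norm_le_by_conv_inverse:
  assumes x: "(\<lambda>l. norm (x l)) summable_on UNIV" and y: "(\<lambda>l. norm (y l)) summable_on UNIV"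
    and v: "\<And>l. norm (v l) \<le> B" and inv: "\<And>k. conv x y k = (if k = 0 then 1 else 0)"
    and u: "\<And>l. norm (conv y v l) \<le> A"
  shows "norm (v k) \<le> norm1 x * A"
  using conv_bound(2)[OF x, of "conv y v" A k] conv_inverse[OF x y v inv] u by simp

section \<open>The truncated Toeplitz system in coefficient form\<close>

lemma powi_has_sum_nonneg:
  fixes \<zeta> :: "'a :: {real_normed_field, banach}"
  assumes "norm \<zeta> < 1"
  shows "((\<lambda>k::int. if k \<ge> 0 then \<zeta> powi k else 0) has_sum (1 / (1 - \<zeta>))) UNIV"
proof -
  have "((\<lambda>k. \<zeta> powi k) has_sum (1 / (1 - \<zeta>))) (range int)"
    using has_sum_geometric[OF assms] by (subst has_sum_reindex) (auto simp: o_def)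
  moreover have "((\<lambda>k. \<zeta> powi k) has_sum (1 / (1 - \<zeta>))) (range int) \<longleftrightarrow> ?thesis"
    by (rule has_sum_cong_neutral) (use zero_le_imp_eq_int in \<open>fastforce simp: image_iff\<close>)+
  ultimately show ?thesis by blast
qed

text \<open>
  \<open>a\<close>, \<open>b\<close>, \<open>c\<close>, \<open>p\<close>, \<open>m\<close> stand for the coefficients of the symbol, of \<open>1 / a\<^sub>+\<close>, \<open>1 / a\<^sub>-\<close>,
  \<open>a\<^sub>+\<close> and \<open>a\<^sub>-\<close>.
\<close>

locale wiener_hopf_coeffs =
  fixes a b c p m :: "int \<Rightarrow> complex" and \<sigma> :: real
  assumes a_summable: "(\<lambda>l. norm (a l)) summable_on UNIV"
    and c_summable: "(\<lambda>l. norm (c l)) summable_on UNIV"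
    and p_summable: "(\<lambda>l. norm (p l)) summable_on UNIV"
    and m_summable: "(\<lambda>l. norm (m l)) summable_on UNIV"
    and \<sigma>: "\<sigma> > 1" and b_summable': "(\<lambda>l. norm (b l) * \<sigma> powi l) summable_on UNIV"
    and b_neg: "\<And>k. k < 0 \<Longrightarrow> b k = 0" and p_neg: "\<And>k. k < 0 \<Longrightarrow> p k = 0"
    and c_pos: "\<And>k. k > 0 \<Longrightarrow> c k = 0" and m_pos: "\<And>k. k > 0 \<Longrightarrow> m k = 0"
    and ca: "\<And>k. conv c a k = p k" and ba: "\<And>k. conv b a k = m k"
    and mc: "\<And>k. conv m c k = (if k = 0 then 1 else 0)"
    and pb: "\<And>k. conv p b k = (if k = 0 then 1 else 0)"
begin

text \<open>Weighted l1 norm: in a sum against \<open>b\<close>, restriction to indices of at least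
  \<open>d\<close> gains \<open>\<sigma>\<close> to the power -d.\<close>

definition "Nb = (\<Sum>\<^sub>\<infinity>l. norm (b l) * \<sigma> powi l)"

lemma b_le: "norm (b l) \<le> norm (b l) * \<sigma> powi l"
proof (cases "l < 0")
  case False
  then have "1 \<le> \<sigma> powi l" using \<sigma> by (simp add: power_int_def one_le_power)
  then show ?thesis using mult_left_mono[of 1 "\<sigma> powi l" "norm (b l)"] by simp
qed (simp add: b_neg)

lemma b_summable: "(\<lambda>l. norm (b l)) summable_on UNIV"
  using b_summable' by (rule summable_on_comparison_test) (auto simp: b_le)

lemma Nb_nonneg: "Nb \<ge> 0"
  unfolding Nb_def using \<sigma> by (intro infsum_nonneg) auto

lemma a_le: "norm (a l) \<le> norm1 a"
  unfolding norm1_def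
  using finite_sum_le_infsum[OF a_summable, of "{l}"] by auto

text \<open>
  With \<open>Q = a * P = D + R + L\<close>, where \<open>R\<close> lives on \<open>k \<ge> n\<close> and \<open>L\<close> on \<open>k < 0\<close>, convolution with \<open>c\<close>
  bounds \<open>L\<close> by \<open>R\<close>, and convolution with \<open>b\<close> bounds \<open>R\<close> by \<open>L\<close> with an exponentially small
  factor. The two bounds close up once \<open>n\<close> is large; this replaces a stability theorem for the
  finite sections.
\<close>

lemma remainder_bound:
  assumes w: "w \<noteq> 0" "norm w < 1"
    and eq: "\<And>k. 0 \<le> k \<Longrightarrow> k < int n \<Longrightarrow> (\<Sum>i<n. a (k - int i) * P i) = w powi k"
    and n: "norm1 p * Nb * norm1 m * norm1 c * \<sigma> powr (- real n) \<le> 1 / 2"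
    and k: "k \<ge> int n"
  shows "norm (\<Sum>i<n. a (k - int i) * P i) \<le>
     2 * (norm1 p * Nb * (1 + norm1 m * norm1 c)) * (\<sigma> powr (- (real n / 2)) + norm w powr (real n / 2))"
proof -
  define Q where "Q = (\<lambda>k. \<Sum>i<n. a (k - int i) * P i)"
  define D where "D = (\<lambda>k. if 0 \<le> k \<and> k < int n then w powi k else 0)"
  define R where "R = (\<lambda>k. if k \<ge> int n then Q k else 0)"
  define L where "L = (\<lambda>k. if k < 0 then Q k else 0)"
  define e where "e = \<sigma> powr (- (real n / 2)) + norm w powr (real n / 2)"
  \<comment> \<open>This depends on \<open>P\<close> and must not reach the result; it only makes
    \<open>S\<close> finite and the convolutions convergent.\<close>
  define qb where "qb = norm1 a * (\<Sum>i<n. norm (P i))"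
  have Q_le: "norm (Q k) \<le> qb" for k
    unfolding Q_def qb_def sum_distrib_left
    by (rule sum_norm_le) (simp add: norm_mult a_le mult_right_mono)
  have qb0: "qb \<ge> 0" using Q_le[of 0] norm_ge_zero order_trans by blast
  have D_le: "norm (D k) \<le> 1" for k
    using w by (auto simp: D_def norm_power power_int_def power_le_one)
  define S where "S = (SUP k. norm (R k))"
  have bdd: "bdd_above (range (\<lambda>k. norm (R k)))"
    by (rule bdd_aboveI[of _ qb]) (auto simp: R_def Q_le qb0)
  have R_le: "norm (R k) \<le> S" for k unfolding S_def by (rule cSUP_upper[OF _ bdd]) auto
  have S0: "S \<ge> 0" using R_le[of 0] norm_ge_zero order_trans by blast
  have L_le': "norm (L k) \<le> qb" for k by (auto simp: L_def Q_le qb0)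
  have QDRL: "Q = (\<lambda>k. D k + (R k + L k))"
    unfolding fun_eq_iff D_def R_def L_def using eq by (auto simp: Q_def)
  have RL_le: "norm (R k + L k) \<le> S + qb" for k
    using norm_triangle_ineq[of "R k" "L k"] R_le[of k] L_le'[of k] by linarith
  have split: "conv x Q k = conv x D k + conv x R k + conv x L k"
    if x: "(\<lambda>l. norm (x l)) summable_on UNIV" for x k
    unfolding QDRL using conv_add[OF x D_le RL_le] conv_add[OF x R_le L_le'] by simp
  have cL: "norm (conv c L k) \<le> norm1 c * (1 + S)" for k
  proof (cases "k < 0")
    case True
    \<comment> \<open>Multiplication by \<open>1 / a_-\<close> turns a P into a_+ P, which has no
      negative indices; there \<open>conv c L\<close> is determined by \<open>D\<close> and
      \<open>R\<close>.\<close>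
    have "conv c Q k = (\<Sum>i<n. p (k - int i) * P i)"
      unfolding Q_def using conv_finite_sum[where a = a and n = n and P = P and k = k, OF c_summable a_le] by (simp add: ca)
    also have "\<dots> = 0" using True by (intro sum.neutral) (auto simp: p_neg)
    finally have "conv c L k = - conv c D k - conv c R k"
      using split[OF c_summable, of k] by (simp add: algebra_simps eq_neg_iff_add_eq_0)
    then have "norm (conv c L k) \<le> norm (conv c D k) + norm (conv c R k)"
      by (metis norm_minus_cancel norm_triangle_ineq4)
    also have "\<dots> \<le> norm1 c * 1 + norm1 c * S"
      by (intro add_mono conv_bound[OF c_summable] D_le R_le)
    finally show ?thesis by (simp add: algebra_simps)
  next
    case False
    have "c l * L (k - l) = 0" for l
      using False by (cases "l > 0") (auto simp: c_pos L_def)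
    then have "conv c L k = 0" unfolding conv_def by (intro infsum_0) auto
    then show ?thesis using S0 norm1_nonneg[of c] by simp
  qed
  have L_le: "norm (L k) \<le> norm1 m * (norm1 c * (1 + S))" for k
    by (rule norm_le_by_conv_inverse[OF m_summable c_summable L_le' mc cL])
  have e_ge: "\<sigma> powr (- real n) \<le> \<sigma> powr (- (real n / 2))"
    using \<sigma> by (intro powr_mono) auto
  have bR: "norm (conv b R k) \<le> Nb * e + Nb * (\<sigma> powr (- real n) * (norm1 m * (norm1 c * (1 + S))))" for k
  proof (cases "k \<ge> int n")
    case True
    \<comment> \<open>Dually, \<open>1 / a_+\<close> turns a P into a_- P, whose indices stay below
      \<open>n\<close>.\<close>
    have "conv b Q k = (\<Sum>i<n. m (k - int i) * P i)"
      unfolding Q_def using conv_finite_sum[where a = a and n = n and P = P and k = k, OF b_summable a_le] by (simp add: ba)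
    also have "\<dots> = 0" using True by (intro sum.neutral) (auto simp: m_pos)
    finally have "conv b R k = - conv b D k - conv b L k"
      using split[OF b_summable, of k] by (simp add: algebra_simps eq_neg_iff_add_eq_0)
    then have "norm (conv b R k) \<le> norm (conv b D k) + norm (conv b L k)"
      by (metis norm_minus_cancel norm_triangle_ineq4)
    also have "norm (conv b D k) \<le> Nb * e"
    proof -
      have "norm (b l * D (k - l)) \<le> norm (b l) * \<sigma> powi l * e" for l
      proof -
        \<comment> \<open>Split at n/2: above it the weight of \<open>b\<close> gains
          \<open>\<sigma>\<close> to the power -n/2; below it \<open>k - l\<close> exceeds n/2
          because \<open>k \<ge> n\<close>, and the power of \<open>w\<close> is small.\<close>
        consider "l < 0" | "l \<ge> 0" "real_of_int l \<ge> real n / 2" | "l \<ge> 0" "real_of_int l < real n / 2"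
          by linarith
        then show ?thesis
        proof cases
          case 1 then show ?thesis by (simp add: b_neg)
        next
          case 2
          have "1 \<le> \<sigma> powi l * \<sigma> powr (- (real n / 2))"
            using \<sigma> 2 by (simp add: powr_real_of_int'[symmetric] powr_add[symmetric] ge_one_powr_ge_zero)
          also have "\<dots> \<le> \<sigma> powi l * e"
            using \<sigma> by (intro mult_left_mono) (auto simp: e_def)
          finally have "norm (b l) * 1 \<le> norm (b l) * (\<sigma> powi l * e)" by (rule mult_left_mono) auto
          moreover have "norm (b l * D (k - l)) \<le> norm (b l) * 1"
            unfolding norm_mult by (rule mult_left_mono[OF D_le]) auto
          ultimately show ?thesis by (simp add: mult.assoc)
        next
          case 3
          have "norm (D (k - l)) \<le> norm w powr (real n / 2)"
          proof (cases "0 \<le> k - l \<and> k - l < int n")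
            case T: True
            have "norm w powi (k - l) = norm w powr real_of_int (k - l)"
              using w powr_real_of_int'[of "norm w" "k - l"] by simp
            also have "\<dots> \<le> norm w powr (real n / 2)"
              using w 3 True by (intro powr_mono') auto
            finally show ?thesis using T by (simp add: D_def norm_power_int)
          qed (auto simp: D_def)
          also have "\<dots> \<le> e" by (simp add: e_def)
          finally have "norm (b l) * norm (D (k - l)) \<le> (norm (b l) * \<sigma> powi l) * e"
            by (intro mult_mono b_le) (use \<sigma> in auto)
          then show ?thesis by (simp add: norm_mult)
        qed
      qed
      from infsum_norm_bound(2)[OF summable_on_cmult_left[OF b_summable'] this]
      show ?thesis unfolding conv_def Nb_def
        by (simp add: infsum_cmult_left' )
    qed
    also have "norm (conv b L k) \<le> Nb * (\<sigma> powr (- real n) * (norm1 m * (norm1 c * (1 + S))))"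
    proof -
      let ?B = "norm1 m * (norm1 c * (1 + S))"
      have B0: "?B \<ge> 0" using S0 by (intro mult_nonneg_nonneg norm1_nonneg) auto
      \<comment> \<open>\<open>L (k - l)\<close> vanishes unless \<open>l > k\<close>, and
        \<open>k \<ge> n\<close>, so the weight gains the full \<open>\<sigma>\<close> to the power
        -n.\<close>
      have "norm (b l * L (k - l)) \<le> norm (b l) * \<sigma> powi l * (\<sigma> powr (- real n) * ?B)" for l
      proof (cases "l > k")
        case T: True
        have "1 \<le> \<sigma> powi l * \<sigma> powr (- real n)"
          using \<sigma> True T by (simp add: powr_real_of_int'[symmetric] powr_add[symmetric] ge_one_powr_ge_zero)
        then have "norm (L (k - l)) \<le> \<sigma> powi l * \<sigma> powr (- real n) * ?B"
          using L_le[of "k - l"] mult_right_mono[OF _ B0] by fastforce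
        then have "norm (b l) * norm (L (k - l)) \<le> norm (b l) * (\<sigma> powi l * \<sigma> powr (- real n) * ?B)"
          by (rule mult_left_mono) auto
        then show ?thesis by (simp add: norm_mult mult_ac)
      next
        case False
        then show ?thesis using B0 \<sigma> by (simp add: L_def)
      qed
      from infsum_norm_bound(2)[OF summable_on_cmult_left[OF b_summable'] this]
      show ?thesis unfolding conv_def Nb_def by (simp add: infsum_cmult_left')
    qed
    finally show ?thesis by simp
  next
    case False
    have "b l * R (k - l) = 0" for l
      using False by (cases "l < 0") (auto simp: b_neg R_def)
    then have "conv b R k = 0" unfolding conv_def by (intro infsum_0) auto
    then show ?thesis
      using S0 Nb_nonneg norm1_nonneg by (auto simp: e_def intro!: add_nonneg_nonneg mult_nonneg_nonneg)
  qed
  define A where "A = Nb * e + Nb * (\<sigma> powr (- real n) * (norm1 m * (norm1 c * (1 + S))))"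
  have "norm (R k) \<le> norm1 p * A" for k
    by (rule norm_le_by_conv_inverse[OF p_summable b_summable R_le pb])
      (use bR in \<open>simp add: A_def\<close>)
  then have "S \<le> norm1 p * A" unfolding S_def by (intro cSUP_least) auto
  also have "norm1 p * A = norm1 p * Nb * e + norm1 p * Nb * norm1 m * norm1 c * \<sigma> powr (- real n)
      + norm1 p * Nb * norm1 m * norm1 c * \<sigma> powr (- real n) * S"
    by (simp add: A_def algebra_simps)
  \<comment> \<open>By the hypothesis \<open>n\<close> the coefficient of \<open>S\<close> is at
    most 1/2. As \<open>S\<close> is finite, the term can be absorbed on the left, which produces
    the factor 2.\<close>
  also have "\<dots> \<le> norm1 p * Nb * e + norm1 p * Nb * norm1 m * norm1 c * e + 1 / 2 * S"
  proof (intro add_mono order_refl)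
    have "\<sigma> powr (- real n) \<le> e" using e_ge by (simp add: e_def add_increasing2)
    then show "norm1 p * Nb * norm1 m * norm1 c * \<sigma> powr (- real n) \<le> norm1 p * Nb * norm1 m * norm1 c * e"
      by (intro mult_left_mono) (auto intro!: mult_nonneg_nonneg Nb_nonneg norm1_nonneg)
  qed (use n S0 in \<open>intro mult_right_mono\<close>)
  finally have "S \<le> 2 * (norm1 p * Nb * (1 + norm1 m * norm1 c)) * e"
    by (simp add: algebra_simps)
  moreover have "norm (Q k) \<le> S" using R_le[of k] k by (simp add: R_def)
  ultimately show ?thesis by (simp add: Q_def e_def)
qed

text \<open>As \<open>c\<close> lives on nonpositive indices, the coefficient of a_+ P at
  \<open>k \<ge> 0\<close> uses a P only at indices from \<open>k\<close> on, so its negative part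
  never enters. There a P is uniformly close to the sequence \<open>w powi k\<close>, an eigenvector
  of convolution with \<open>c\<close> with eigenvalue \<open>cw\<close>. Summation against powers
  of \<open>\<zeta>\<close> costs \<open>1 / (1 - norm \<zeta>)\<close>.\<close>

lemma generating_function_estimate:
  assumes w: "w \<noteq> 0" "norm w < 1"
    and eq: "\<And>k. 0 \<le> k \<Longrightarrow> k < int n \<Longrightarrow> (\<Sum>i<n. a (k - int i) * P i) = w powi k"
    and n: "norm1 p * Nb * norm1 m * norm1 c * \<sigma> powr (- real n) \<le> 1 / 2"
    and \<zeta>: "\<zeta> \<noteq> 0" "norm \<zeta> < 1"
    and pz: "((\<lambda>k. p k * \<zeta> powi k) has_sum pz) UNIV"
    and cw: "((\<lambda>k. c k * w powi (- k)) has_sum cw) UNIV"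
  shows "norm (pz * (\<Sum>i<n. P i * \<zeta> ^ i) - cw / (1 - w * \<zeta>)) \<le>
    norm1 c * (2 * (norm1 p * Nb * (1 + norm1 m * norm1 c)) + 1)
      * (\<sigma> powr (- (real n / 2)) + norm w powr (real n / 2)) / (1 - norm \<zeta>)"
proof -
  define Q where "Q = (\<lambda>k. \<Sum>i<n. a (k - int i) * P i)"
  define T where "T = (\<lambda>k. \<Sum>i<n. p (k - int i) * P i)"
  define e where "e = \<sigma> powr (- (real n / 2)) + norm w powr (real n / 2)"
  define K where "K = 2 * (norm1 p * Nb * (1 + norm1 m * norm1 c))"
  have K0: "K \<ge> 0" unfolding K_def
    by (intro mult_nonneg_nonneg add_nonneg_nonneg Nb_nonneg norm1_nonneg) auto
  have e0: "e \<ge> 0" by (simp add: e_def)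
  have Q_le: "norm (Q k) \<le> norm1 a * (\<Sum>i<n. norm (P i))" for k
    unfolding Q_def sum_distrib_left
    by (rule sum_norm_le) (simp add: norm_mult a_le mult_right_mono)
  \<comment> \<open>The two agree below \<open>n\<close>; from \<open>n\<close> on both are small,
    \<open>Q\<close> by the remainder bound and the power of \<open>w\<close> by itself, hence
    \<open>K + 1\<close>.\<close>
  have Q_diff: "norm (Q k - w powi k) \<le> (K + 1) * e" if "k \<ge> 0" for k
  proof (cases "k < int n")
    case True
    then show ?thesis using eq[of k] that K0 e0 by (simp add: Q_def)
  next
    case False
    have "norm (Q k) \<le> K * e"
      using remainder_bound[OF w eq n] False by (simp add: Q_def K_def e_def)
    moreover have "norm (w powi k) \<le> e"
    proof -
      have "norm (w powi k) = norm w powr real_of_int k"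
        using w by (simp add: norm_power_int powr_real_of_int')
      also have "\<dots> \<le> norm w powr (real n / 2)"
        using w False by (intro powr_mono') auto
      finally show ?thesis by (simp add: e_def add_increasing)
    qed
    ultimately show ?thesis
      using norm_triangle_ineq4[of "Q k" "w powi k"] by (simp add: algebra_simps)
  qed
  have cQ: "conv c Q k = T k" for k
    unfolding Q_def T_def using conv_finite_sum[where a = a and n = n and P = P and k = k, OF c_summable a_le]
    by (simp add: ca)
  have T_neg: "T k = 0" if "k < 0" for k
    unfolding T_def using that by (intro sum.neutral) (auto simp: p_neg)
  have T_diff: "norm (T k - cw * w powi k) \<le> norm1 c * ((K + 1) * e)" if "k \<ge> 0" for k
  proof -
    have "((\<lambda>l. c l * Q (k - l)) has_sum T k) UNIV"
      unfolding cQ[symmetric] conv_def by (intro has_sum_infsum conv_bound(1)[OF c_summable Q_le])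
    moreover have "((\<lambda>l. c l * w powi (- l) * w powi k) has_sum (cw * w powi k)) UNIV"
      by (rule has_sum_cmult_left[OF cw])
    ultimately have "((\<lambda>l. c l * Q (k - l) - c l * w powi (- l) * w powi k) has_sum (T k - cw * w powi k)) UNIV"
      by (rule has_sum_diff)
    moreover have "((\<lambda>l. norm (c l) * ((K + 1) * e)) has_sum (norm1 c * ((K + 1) * e))) UNIV"
      unfolding norm1_def by (intro has_sum_cmult_left has_sum_infsum c_summable)
    moreover have "norm (c l * Q (k - l) - c l * w powi (- l) * w powi k) \<le> norm (c l) * ((K + 1) * e)" for l
    proof (cases "l > 0")
      case False
      have "w powi (- l) * w powi k = w powi (k - l)"
        using w power_int_add[of w "- l" k] by (simp add: algebra_simps)
      then have "c l * Q (k - l) - c l * w powi (- l) * w powi k = c l * (Q (k - l) - w powi (k - l))"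
        by (simp add: algebra_simps)
      then show ?thesis
        using Q_diff[of "k - l"] False that by (simp add: norm_mult mult_left_mono)
    qed (use c_pos in simp)
    ultimately show ?thesis by (rule norm_infsum_le)
  qed
  have shift: "((\<lambda>k. p (k - int i) * P i * \<zeta> powi k) has_sum (pz * (P i * \<zeta> ^ i))) UNIV" for i
  proof -
    have "((\<lambda>k. p k * \<zeta> powi k * (P i * \<zeta> ^ i)) has_sum (pz * (P i * \<zeta> ^ i))) UNIV"
      by (rule has_sum_cmult_left[OF pz])
    moreover have "((\<lambda>k. p (k - int i) * P i * \<zeta> powi k) has_sum (pz * (P i * \<zeta> ^ i))) UNIV \<longleftrightarrow>
        ((\<lambda>k. p k * \<zeta> powi k * (P i * \<zeta> ^ i)) has_sum (pz * (P i * \<zeta> ^ i))) UNIV"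
    proof (rule has_sum_reindex_bij_witness[where i = "\<lambda>k. k + int i" and j = "\<lambda>k. k - int i"])
      fix k
      have "\<zeta> powi k = \<zeta> powi (k - int i) * \<zeta> ^ i"
        using \<zeta> power_int_add[of \<zeta> "k - int i" "int i"] by simp
      then show "p (k - int i) * \<zeta> powi (k - int i) * (P i * \<zeta> ^ i) = p (k - int i) * P i * \<zeta> powi k"
        by simp
    qed auto
    ultimately show ?thesis by simp
  qed
  have "((\<lambda>k. T k * \<zeta> powi k) has_sum (pz * (\<Sum>i<n. P i * \<zeta> ^ i))) UNIV"
    unfolding T_def sum_distrib_left sum_distrib_right by (intro has_sum_sum shift)
  moreover have "norm (w * \<zeta>) < 1"
    using w \<zeta> mult_strict_mono[of "norm w" 1 "norm \<zeta>" 1] by (simp add: norm_mult)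
  then have "((\<lambda>k. cw * (if k \<ge> 0 then (w * \<zeta>) powi k else 0)) has_sum (cw * (1 / (1 - w * \<zeta>)))) UNIV"
    by (intro has_sum_cmult_right powi_has_sum_nonneg)
  ultimately have "((\<lambda>k. T k * \<zeta> powi k - cw * (if k \<ge> 0 then (w * \<zeta>) powi k else 0)) has_sum
      (pz * (\<Sum>i<n. P i * \<zeta> ^ i) - cw * (1 / (1 - w * \<zeta>)))) UNIV"
    by (rule has_sum_diff)
  moreover have "((\<lambda>k. norm1 c * ((K + 1) * e) * (if k \<ge> 0 then norm \<zeta> powi k else 0)) has_sum
      (norm1 c * ((K + 1) * e) * (1 / (1 - norm \<zeta>)))) UNIV"
    by (intro has_sum_cmult_right powi_has_sum_nonneg) (use \<zeta> in simp)
  moreover have "norm (T k * \<zeta> powi k - cw * (if k \<ge> 0 then (w * \<zeta>) powi k else 0)) \<le>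
      norm1 c * ((K + 1) * e) * (if k \<ge> 0 then norm \<zeta> powi k else 0)" for k
  proof (cases "k \<ge> 0")
    case True
    then have "T k * \<zeta> powi k - cw * (if k \<ge> 0 then (w * \<zeta>) powi k else 0) = (T k - cw * w powi k) * \<zeta> powi k"
      by (simp add: power_int_mult_distrib algebra_simps)
    then show ?thesis using True mult_right_mono[OF T_diff[OF True], of "norm \<zeta> powi k"]
      by (simp add: norm_mult norm_power_int)
  qed (simp add: T_neg)
  ultimately have "norm (pz * (\<Sum>i<n. P i * \<zeta> ^ i) - cw * (1 / (1 - w * \<zeta>))) \<le>
      norm1 c * ((K + 1) * e) * (1 / (1 - norm \<zeta>))"
    by (rule norm_infsum_le)
  then show ?thesis by (simp add: K_def e_def mult.assoc)
qed

end

section \<open>Analytic continuation of the Wiener--Hopf factors\<close>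

text \<open>By compactness \<open>U\<close> contains all points within a fixed distance of the
  closed annulus; a point just outside is compared with its radial projection. The case
  \<open>r = s\<close> gives an annulus around a circle.\<close>

lemma annulus_neighbourhood:
  fixes U :: "complex set"
  assumes "open U" "{z. r \<le> norm z \<and> norm z \<le> s} \<subseteq> U" "0 < r" "r \<le> s"
  obtains \<eta> where "\<eta> > 0" "{z. r - \<eta> < norm z \<and> norm z < s + \<eta>} \<subseteq> U"
proof -
  have "closed {z::complex. r \<le> norm z \<and> norm z \<le> s}"
    by (intro closed_Collect_conj closed_Collect_le continuous_intros)
  moreover have "bounded {z::complex. r \<le> norm z \<and> norm z \<le> s}"
    by (auto simp: bounded_iff)
  ultimately have "compact {z::complex. r \<le> norm z \<and> norm z \<le> s}"
    by (simp add: compact_eq_bounded_closed)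
  then obtain e where e: "e > 0" "(\<Union>x\<in>{z. r \<le> norm z \<and> norm z \<le> s}. ball x e) \<subseteq> U"
    using compact_subset_open_imp_ball_epsilon_subset assms by metis
  have close: "u \<in> U" if u: "u \<noteq> 0" "r \<le> t" "t \<le> s" "\<bar>norm u - t\<bar> < e" for u :: complex and t
  proof -
    define v where "v = complex_of_real (t / norm u) * u"
    have "norm v = t" using u \<open>0 < r\<close> by (simp add: v_def norm_mult norm_divide)
    moreover have "v - u = complex_of_real ((t - norm u) / norm u) * u"
      using u by (simp add: v_def field_simps)
    then have "dist v u = \<bar>(t - norm u) / norm u\<bar> * norm u"
      by (simp only: dist_norm norm_mult norm_of_real)
    then have "dist v u = \<bar>norm u - t\<bar>"
      using u by (simp add: abs_minus_commute)
    ultimately show ?thesis using u e by (intro subsetD[OF e(2)]) auto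
  qed
  \<comment> \<open>\<open>d \<le> r\<close> excludes the origin, which has no radial
    projection.\<close>
  define d where "d = min e r"
  show ?thesis
  proof (rule that[of d])
    show "d > 0" using e assms by (simp add: d_def)
    show "{z. r - d < norm z \<and> norm z < s + d} \<subseteq> U"
    proof safe
      fix u :: complex assume u: "r - d < norm u" "norm u < s + d"
      then have "u \<noteq> 0" by (auto simp: d_def)
      then show "u \<in> U"
        using close[of u "max r (min s (norm u))"] u assms e by (auto simp: d_def)
    qed
  qed
qed

text \<open>The circle becomes the imaginary axis in the coordinate \<open>ln z\<close>, where Morera's theorem applies.\<close>

lemma holomorphic_on_glue_circle:
  assumes r1: "0 \<le> r1" and cont: "continuous_on {z. r1 < norm z \<and> norm z < r2} g"
    and h1: "g holomorphic_on {z. r1 < norm z \<and> norm z < r2 \<and> norm z < 1}"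
    and h2: "g holomorphic_on {z. r1 < norm z \<and> norm z < r2 \<and> 1 < norm z}"
  shows "g holomorphic_on {z. r1 < norm z \<and> norm z < r2}"
proof -
  let ?A = "{z::complex. r1 < norm z \<and> norm z < r2}"
  define S where "S = {u. r1 < exp (Re u) \<and> exp (Re u) < r2}"
  have S: "open S" unfolding S_def
    by (intro open_Collect_conj open_Collect_less continuous_intros)
  define G where "G = (\<lambda>u. g (exp u))"
  have G: "G holomorphic_on S"
  proof (rule holomorphic_on_paste_across_line[OF S, of 1 _ 0])
    show "G holomorphic_on S \<inter> {z. 1 \<bullet> z < 0}" unfolding G_def
      by (rule holomorphic_on_compose_gen[OF holomorphic_on_exp h1, unfolded o_def])
        (auto simp: S_def inner_complex_def)
    show "G holomorphic_on S \<inter> {z. 0 < 1 \<bullet> z}" unfolding G_def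
      by (rule holomorphic_on_compose_gen[OF holomorphic_on_exp h2, unfolded o_def])
        (auto simp: S_def inner_complex_def)
    show "continuous_on S G" unfolding G_def
      by (rule continuous_on_compose2[OF cont]) (auto intro!: continuous_intros simp: S_def)
  qed auto
  \<comment> \<open>Two branches of the logarithm with opposite cuts: \<open>exp\<close> inverts
    both, and the two slit annuli cover the annulus, so holomorphy of \<open>G\<close> passes back
    to \<open>g\<close>.\<close>
  have mem: "Ln z \<in> S" "Ln (- z) + \<i> * of_real pi \<in> S" if "z \<in> ?A" for z
  proof -
    have "z \<noteq> 0" using that r1 by auto
    then show "Ln z \<in> S" "Ln (- z) + \<i> * of_real pi \<in> S" using that by (auto simp: S_def)
  qed
  have "(\<lambda>z. G (Ln z)) holomorphic_on (?A - \<real>\<^sub>\<le>\<^sub>0)"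
    by (rule holomorphic_on_compose_gen[OF _ G, unfolded o_def])
      (use mem in \<open>auto intro!: holomorphic_intros\<close>)
  moreover have "G (Ln z) = g z" if "z \<in> ?A - \<real>\<^sub>\<le>\<^sub>0" for z
  proof -
    have "z \<noteq> 0" using that r1 by auto
    then show ?thesis by (simp add: G_def)
  qed
  ultimately have 1: "g holomorphic_on (?A - \<real>\<^sub>\<le>\<^sub>0)"
    by (rule holomorphic_transform)
  have "(\<lambda>z. G (Ln (- z) + \<i> * of_real pi)) holomorphic_on (?A - uminus -` \<real>\<^sub>\<le>\<^sub>0)"
    by (rule holomorphic_on_compose_gen[OF _ G, unfolded o_def])
      (use mem in \<open>auto intro!: holomorphic_intros\<close>)
  moreover have "G (Ln (- z) + \<i> * of_real pi) = g z" if "z \<in> ?A - uminus -` \<real>\<^sub>\<le>\<^sub>0" for z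
  proof -
    have "z \<noteq> 0" using that r1 by auto
    then show ?thesis by (simp add: G_def exp_add)
  qed
  ultimately have 2: "g holomorphic_on (?A - uminus -` \<real>\<^sub>\<le>\<^sub>0)"
    by (rule holomorphic_transform)
  have "closed (uminus -` (\<real>\<^sub>\<le>\<^sub>0 :: complex set))"
    by (intro continuous_closed_vimage closed_nonpos_Reals_complex) (auto intro!: continuous_intros)
  then have "g holomorphic_on ((?A - \<real>\<^sub>\<le>\<^sub>0) \<union> (?A - uminus -` \<real>\<^sub>\<le>\<^sub>0))"
    by (intro holomorphic_on_Un 1 2 open_Diff open_annulus closed_nonpos_Reals_complex)
  moreover have "?A \<subseteq> (?A - \<real>\<^sub>\<le>\<^sub>0) \<union> (?A - uminus -` \<real>\<^sub>\<le>\<^sub>0)"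
  proof
    fix z assume z: "z \<in> ?A"
    then have "z \<noteq> 0" using r1 by auto
    then have "\<not> (z \<in> \<real>\<^sub>\<le>\<^sub>0 \<and> - z \<in> \<real>\<^sub>\<le>\<^sub>0)"
      by (auto simp: complex_nonpos_Reals_iff complex_eq_iff)
    then show "z \<in> (?A - \<real>\<^sub>\<le>\<^sub>0) \<union> (?A - uminus -` \<real>\<^sub>\<le>\<^sub>0)" using z by auto
  qed
  ultimately show ?thesis by (rule holomorphic_on_subset)
qed

text \<open>The pieces \<open>fp\<close> inside and \<open>f / fm\<close> outside are holomorphic,
  and the product identity makes them agree on the circle, so they can be glued.\<close>

lemma wh_plus_holomorphic:
  assumes wh: "wiener_hopf f fp fm" and f: "f holomorphic_on {z. 1 - e < norm z \<and> norm z < 1 + e}" and "e > 0"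
  shows "wh_plus f fp fm holomorphic_on {z. norm z < 1 + e}"
proof -
  \<comment> \<open>Gluing needs a nonnegative inner radius, and \<open>1 - e\<close> may be
    negative; the open unit disc covers what is lost.\<close>
  let ?g = "wh_plus f fp fm" and ?r = "max 0 (1 - e)"
  note wh' = wh[unfolded wiener_hopf_def]
  have inner: "?g holomorphic_on {z. norm z < 1}"
    by (rule holomorphic_transform[of fp]) (use wh' in \<open>auto simp: wh_plus_def\<close>)
  have "(\<lambda>z. f z / fm z) holomorphic_on {z. 1 < norm z \<and> norm z < 1 + e}"
    using wh' \<open>e > 0\<close>
    by (intro holomorphic_on_divide) (auto elim: holomorphic_on_subset intro: holomorphic_on_subset[OF f])
  then have outer: "?g holomorphic_on {z. 1 < norm z \<and> norm z < 1 + e}"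
    by (rule holomorphic_transform) (auto simp: wh_plus_def)
  have "continuous_on {z. ?r < norm z \<and> norm z < 1 + e} (\<lambda>z. if norm z \<le> 1 then fp z else f z / fm z)"
  proof (rule continuous_on_cases_le)
    show "continuous_on {t \<in> {z. ?r < norm z \<and> norm z < 1 + e}. norm t \<le> 1} fp"
      using wh' by (auto elim: continuous_on_subset)
    show "continuous_on {t \<in> {z. ?r < norm z \<and> norm z < 1 + e}. 1 \<le> norm t} (\<lambda>z. f z / fm z)"
      using wh' \<open>e > 0\<close>
      by (intro continuous_on_divide)
        (auto elim: continuous_on_subset intro: continuous_on_subset[OF holomorphic_on_imp_continuous_on[OF f]])
    show "fp t = f t / fm t" if "norm t = 1" for t using wh' that by simp
  qed (auto intro: continuous_intros)
  then have "?g holomorphic_on {z. ?r < norm z \<and> norm z < 1 + e}"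
    using inner outer
    by (intro holomorphic_on_glue_circle) (auto simp: wh_plus_def[abs_def] elim: holomorphic_on_subset)
  then have "?g holomorphic_on ({z. norm z < 1} \<union> {z. ?r < norm z \<and> norm z < 1 + e})"
    by (intro holomorphic_on_Un inner open_annulus open_Collect_less continuous_intros)
  then show ?thesis by (rule holomorphic_on_subset) (use \<open>e > 0\<close> in auto)
qed

lemma wh_minus_holomorphic:
  assumes wh: "wiener_hopf f fp fm" and f: "f holomorphic_on {z. 1 - e < norm z \<and> norm z < 1 + e}" and "e > 0"
  shows "wh_minus f fp fm holomorphic_on {z. 1 - e < norm z}"
proof -
  let ?g = "wh_minus f fp fm" and ?r = "max 0 (1 - e)"
  note wh' = wh[unfolded wiener_hopf_def]
  have outer: "?g holomorphic_on {z. 1 < norm z}"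
    by (rule holomorphic_transform[of fm]) (use wh' in \<open>auto simp: wh_minus_def\<close>)
  have "(\<lambda>z. f z / fp z) holomorphic_on {z. 1 - e < norm z \<and> norm z < 1}"
    using wh' \<open>e > 0\<close>
    by (intro holomorphic_on_divide) (auto elim: holomorphic_on_subset intro: holomorphic_on_subset[OF f])
  then have inner: "?g holomorphic_on {z. 1 - e < norm z \<and> norm z < 1}"
    by (rule holomorphic_transform) (auto simp: wh_minus_def)
  have "continuous_on {z. ?r < norm z \<and> norm z < 1 + e} (\<lambda>z. if norm z \<le> 1 then f z / fp z else fm z)"
  proof (rule continuous_on_cases_le)
    show "continuous_on {t \<in> {z. ?r < norm z \<and> norm z < 1 + e}. 1 \<le> norm t} fm"
      using wh' by (auto elim: continuous_on_subset)
    show "continuous_on {t \<in> {z. ?r < norm z \<and> norm z < 1 + e}. norm t \<le> 1} (\<lambda>z. f z / fp z)"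
      using wh' \<open>e > 0\<close>
      by (intro continuous_on_divide)
        (auto elim: continuous_on_subset intro: continuous_on_subset[OF holomorphic_on_imp_continuous_on[OF f]])
    show "f t / fp t = fm t" if "norm t = 1" for t using wh' that by simp
  qed (auto intro: continuous_intros)
  moreover have "(\<lambda>z. if norm z \<le> 1 then f z / fp z else fm z) = ?g"
    using wh' by (fastforce simp: wh_minus_def)
  ultimately have "continuous_on {z. ?r < norm z \<and> norm z < 1 + e} ?g" by (simp only:)
  then have "?g holomorphic_on {z. ?r < norm z \<and> norm z < 1 + e}"
    using inner outer by (intro holomorphic_on_glue_circle) (auto elim: holomorphic_on_subset)
  \<comment> \<open>For \<open>e > 1\<close> the target contains the origin, which the glued annulus
    misses and the inner piece supplies.\<close>
  then have "?g holomorphic_on ({z. 1 - e < norm z \<and> norm z < 1} \<union> 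
     ({z. ?r < norm z \<and> norm z < 1 + e} \<union> {z. 1 < norm z}))"
    by (intro holomorphic_on_Un inner outer open_annulus open_Un open_Collect_less continuous_intros)
  then show ?thesis by (rule holomorphic_on_subset) (use \<open>e > 0\<close> in auto)
qed

lemma wh_plus_times_wh_minus:
  assumes "wiener_hopf f fp fm"
  shows "wh_plus f fp fm z * wh_minus f fp fm z = f z"
  using assms by (cases "norm z = 1") (auto simp: wiener_hopf_def wh_plus_def wh_minus_def)

lemma wh_minus_tendsto:
  assumes "wiener_hopf f fp fm"
  obtains L where "L \<noteq> 0" "(wh_minus f fp fm \<longlongrightarrow> L) at_infinity"
proof -
  obtain L where L: "L \<noteq> 0" "(fm \<longlongrightarrow> L) at_infinity" using assms by (auto simp: wiener_hopf_def)
  have "eventually (\<lambda>z. fm z = wh_minus f fp fm z) at_infinity"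
    unfolding eventually_at_infinity by (auto simp: wh_minus_def intro!: exI[of _ 1])
  with L(2) have "(wh_minus f fp fm \<longlongrightarrow> L) at_infinity"
    by (rule Lim_transform_eventually)
  with L(1) show ?thesis by (rule that)
qed

lemma conv_fourier_coeff:
  assumes "g holomorphic_on {z. r1 < norm z \<and> norm z < r2}" "r1 < 1" "1 < r2"
    and "continuous_on {z. norm z = 1} h"
    and "\<And>z. norm z = 1 \<Longrightarrow> g z * h z = q z"
  shows "conv (fourier_coeff g) (fourier_coeff h) k = fourier_coeff q k"
  using infsumI[OF fourier_coeff_mult[OF assms(1-4), of k]] fourier_coeff_cong[OF assms(5)]
  by (simp add: conv_def)

text \<open>Zero-free continuation past the circle makes all five sequences summable; the weight
  radius \<open>1 + \<delta> / 2\<close> stays inside the region of analyticity of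
  \<open>1 / ap\<close>. A finite limit at infinity removes the positive powers of
  \<open>am\<close>, and \<open>L \<noteq> 0\<close> those of its reciprocal.\<close>

lemma wiener_hopf_coeffs_fourier:
  assumes \<delta>: "0 < \<delta>" and ap: "ap holomorphic_on {z. norm z < 1 + \<delta>}" "\<And>z. norm z < 1 + \<delta> \<Longrightarrow> ap z \<noteq> 0"
    and am: "am holomorphic_on {z. 1 - \<delta> < norm z}" "\<And>z. 1 - \<delta> < norm z \<Longrightarrow> am z \<noteq> 0"
    and lim: "(am \<longlongrightarrow> L) at_infinity" "L \<noteq> 0"
  shows "wiener_hopf_coeffs (fourier_coeff (\<lambda>z. ap z * am z)) (fourier_coeff (\<lambda>z. 1 / ap z))
    (fourier_coeff (\<lambda>z. 1 / am z)) (fourier_coeff ap) (fourier_coeff am) (1 + \<delta> / 2)"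
proof -
  let ?A = "{z. 1 - \<delta> < norm z \<and> norm z < 1 + \<delta>}"
  have b: "(\<lambda>z. 1 / ap z) holomorphic_on {z. norm z < 1 + \<delta>}"
    using ap by (intro holomorphic_intros) auto
  have c: "(\<lambda>z. 1 / am z) holomorphic_on {z. 1 - \<delta> < norm z}"
    using am by (intro holomorphic_intros) auto
  have p': "ap holomorphic_on ?A" and b': "(\<lambda>z. 1 / ap z) holomorphic_on ?A"
    and m': "am holomorphic_on ?A" and c': "(\<lambda>z. 1 / am z) holomorphic_on ?A"
    using ap(1) b am(1) c by (auto elim: holomorphic_on_subset)
  have a': "(\<lambda>z. ap z * am z) holomorphic_on ?A" using p' m' by (intro holomorphic_intros)
  have circ: "continuous_on {z. norm z = 1} h" if "h holomorphic_on ?A" for h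
    by (rule continuous_on_subset[OF holomorphic_on_imp_continuous_on[OF that]]) (use \<delta> in auto)
  have sm: "(\<lambda>l. norm (fourier_coeff h l)) summable_on UNIV" if "h holomorphic_on ?A" for h
    using fourier_coeff_summable[OF that, of 1] \<delta> by simp
  have nz: "ap z \<noteq> 0" "am z \<noteq> 0" if "norm z = 1" for z
    using ap(2)[of z] am(2)[of z] that \<delta> by auto
  have del: "fourier_coeff (\<lambda>z. 1) k = (if k = 0 then 1 else 0)" for k by (rule fourier_coeff_1)
  have lim': "((\<lambda>z. 1 / am z) \<longlongrightarrow> 1 / L) at_infinity" using lim by (intro tendsto_intros)
  define s where "s = complex_of_real (1 + \<delta> / 2)"
  have s: "norm s = 1 + \<delta> / 2" unfolding s_def norm_of_real using \<delta> by simp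
  then have "s \<noteq> 0" using \<delta> by auto
  show ?thesis
  proof
    show "(\<lambda>l. norm (fourier_coeff (\<lambda>z. 1 / ap z) l) * (1 + \<delta> / 2) powi l) summable_on UNIV"
      using fourier_coeff_summable[OF b', of s] \<delta> s \<open>s \<noteq> 0\<close>
      by (simp add: norm_mult norm_power_int)
    show "conv (fourier_coeff (\<lambda>z. 1 / am z)) (fourier_coeff (\<lambda>z. ap z * am z)) k = fourier_coeff ap k" for k
      by (rule conv_fourier_coeff[OF c']) (use \<delta> nz circ[OF a'] in auto)
    show "conv (fourier_coeff (\<lambda>z. 1 / ap z)) (fourier_coeff (\<lambda>z. ap z * am z)) k = fourier_coeff am k" for k
      by (rule conv_fourier_coeff[OF b']) (use \<delta> nz circ[OF a'] in auto)
    show "conv (fourier_coeff am) (fourier_coeff (\<lambda>z. 1 / am z)) k = (if k = 0 then 1 else 0)" for k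
      unfolding del[symmetric] by (rule conv_fourier_coeff[OF m']) (use \<delta> nz circ[OF c'] in auto)
    show "conv (fourier_coeff ap) (fourier_coeff (\<lambda>z. 1 / ap z)) k = (if k = 0 then 1 else 0)" for k
      unfolding del[symmetric] by (rule conv_fourier_coeff[OF p']) (use \<delta> nz circ[OF b'] in auto)
    show "fourier_coeff (\<lambda>z. 1 / ap z) k = 0" "fourier_coeff ap k = 0" if "k < 0" for k
      using fourier_coeff_neg_eq_0[OF b _ that] fourier_coeff_neg_eq_0[OF ap(1) _ that] \<delta> by auto
    show "fourier_coeff (\<lambda>z. 1 / am z) k = 0" "fourier_coeff am k = 0" if "k > 0" for k
      using fourier_coeff_pos_eq_0[OF c _ that lim'] fourier_coeff_pos_eq_0[OF am(1) _ that lim(1)] \<delta> by auto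
  qed (use \<delta> sm[OF a'] sm[OF c'] sm[OF p'] sm[OF m'] in auto)
qed

section \<open>Inverses of Toeplitz matrices\<close>

text \<open>Trades the exponential decay of the truncation error for the power of \<open>n\<close>
  in the final rate.\<close>

lemma powr_decay_bound:
  fixes \<sigma> \<alpha> :: real
  assumes "\<sigma> > 1"
  obtains C where "C > 0" "\<And>n::nat. n \<ge> 1 \<Longrightarrow> \<sigma> powr (- (real n / 2)) \<le> C * (1 / real n powr \<alpha>)"
proof -
  have "(\<lambda>n::nat. \<sigma> powr (- (real n / 2)) * real n powr \<alpha>) \<longlonglongrightarrow> 0"
    using assms by real_asymp
  then have "Bseq (\<lambda>n::nat. \<sigma> powr (- (real n / 2)) * real n powr \<alpha>)"
    by (intro convergent_imp_Bseq) (auto simp: convergent_def)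
  then obtain C where C: "C > 0" "\<And>n. norm (\<sigma> powr (- (real n / 2)) * real n powr \<alpha>) \<le> C"
    by (auto simp: Bseq_def)
  show ?thesis
  proof (rule that[OF C(1)])
    fix n :: nat assume "n \<ge> 1"
    then show "\<sigma> powr (- (real n / 2)) \<le> C * (1 / real n powr \<alpha>)"
      using C(2)[of n] by (simp add: pos_le_divide_eq)
  qed
qed

lemma eventually_powr_small:
  fixes \<sigma> K :: real
  assumes "\<sigma> > 1"
  obtains N :: nat where "\<And>n. n \<ge> N \<Longrightarrow> K * \<sigma> powr (- real n) \<le> 1 / 2"
proof -
  have "(\<lambda>n::nat. \<sigma> powr (- real n)) \<longlonglongrightarrow> 0" using assms by real_asymp
  then have "(\<lambda>n::nat. K * \<sigma> powr (- real n)) \<longlonglongrightarrow> K * 0" by (intro tendsto_intros)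
  then have "eventually (\<lambda>n. K * \<sigma> powr (- real n) < 1 / 2) sequentially"
    by (rule order_tendstoD) simp
  then show ?thesis using that by (auto simp: eventually_sequentially intro: less_imp_le)
qed

text \<open>The core estimate, with the prefactors of the kernel stripped off. \<open>V\<close> is
  fixed before \<open>C\<close>, so \<open>C\<close> may depend on finitely many of the matrices,
  but not on \<open>n\<close>, \<open>z\<close> or \<open>w\<close>.\<close>

lemma toeplitz_inverse_estimate:
  fixes ap am :: "complex \<Rightarrow> complex" and V :: "nat \<Rightarrow> nat \<Rightarrow> nat \<Rightarrow> complex"
  assumes \<delta>: "0 < \<delta>" and ap: "ap holomorphic_on {z. norm z < 1 + \<delta>}" "\<And>z. norm z < 1 + \<delta> \<Longrightarrow> ap z \<noteq> 0"
    and am: "am holomorphic_on {z. 1 - \<delta> < norm z}" "\<And>z. 1 - \<delta> < norm z \<Longrightarrow> am z \<noteq> 0"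
    and lim: "(am \<longlongrightarrow> L) at_infinity" "L \<noteq> 0"
    and \<epsilon>: "\<epsilon> > 0"
  shows "\<exists>C. \<forall>n\<ge>1. (\<forall>k<n. \<forall>j<n. (\<Sum>i<n. fourier_coeff (\<lambda>z. ap z * am z) (int k - int i) * V n i j)
          = (if k = j then 1 else 0)) \<longrightarrow>
     (\<forall>z w. w \<noteq> 0 \<and> norm w < 1 \<and> 1 < norm z \<and> norm z < 1 + \<epsilon> \<longrightarrow>
       norm ((\<Sum>i<n. (\<Sum>j<n. V n i j * w ^ j) * (1 / z) ^ i) - z / (z - w) / (ap (1 / z) * am (1 / w)))
         \<le> C * (1 / ((norm z - 1) * (1 - norm w)) *
             (1 / real n powr \<alpha> + norm w powr (real n / 2) + 1 / norm z powr (real n / 2))))"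
proof -
  define a b c p m where "a = fourier_coeff (\<lambda>z. ap z * am z)" and "b = fourier_coeff (\<lambda>z. 1 / ap z)"
    and "c = fourier_coeff (\<lambda>z. 1 / am z)" and "p = fourier_coeff ap" and "m = fourier_coeff am"
  define \<sigma> where "\<sigma> = 1 + \<delta> / 2"
  interpret W: wiener_hopf_coeffs a b c p m \<sigma>
    unfolding a_def b_def c_def p_def m_def \<sigma>_def
    by (rule wiener_hopf_coeffs_fourier) (fact assms)+
  have p_sum: "((\<lambda>k. p k * \<zeta> powi k) has_sum ap \<zeta>) UNIV" if "\<zeta> \<noteq> 0" "norm \<zeta> < 1" for \<zeta>
    unfolding p_def
    by (rule laurent_has_sum[where ?r1.0 = 0 and ?r2.0 = "1 + \<delta>"])
      (use \<delta> that in \<open>auto intro: holomorphic_on_subset[OF ap(1)]\<close>)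
  have c_sum: "((\<lambda>k. c k * w powi (- k)) has_sum (1 / am (1 / w))) UNIV" if w: "w \<noteq> 0" "norm w < 1" for w
  proof -
    have "1 < norm (1 / w)" using w by (simp add: norm_divide field_simps)
    then have "((\<lambda>k. c k * (1 / w) powi k) has_sum (1 / am (1 / w))) UNIV"
      unfolding c_def
      by (intro laurent_has_sum[where ?r1.0 = "1 - \<delta>" and ?r2.0 = "norm (1 / w) + 1"]
          holomorphic_on_divide holomorphic_on_subset[OF am(1)] holomorphic_intros)
        (use \<delta> am(2) w in auto)
    then show ?thesis by (simp add: power_int_minus power_int_divide_distrib divide_inverse power_int_inverse)
  qed
  \<comment> \<open>Only nonnegative powers of \<open>w\<close> carry a nonzero coefficient, so the
    bound is uniform down to \<open>w\<close> near 0.\<close>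
  have c_le: "norm (1 / am (1 / w)) \<le> norm1 c" if w: "w \<noteq> 0" "norm w < 1" for w
  proof (rule norm_infsum_le[OF c_sum[OF w]])
    show "((\<lambda>k. norm (c k)) has_sum norm1 c) UNIV"
      unfolding norm1_def by (intro has_sum_infsum W.c_summable)
    show "norm (c k * w powi (- k)) \<le> norm (c k)" for k
    proof (cases "k > 0")
      case False
      then have "norm (w powi (- k)) \<le> 1" using w by (simp add: power_int_def norm_power power_le_one)
      then show ?thesis by (simp add: norm_mult mult_left_le)
    qed (simp add: W.c_pos)
  qed
  obtain B where B: "B > 0" "\<And>\<zeta>. norm \<zeta> \<le> 1 \<Longrightarrow> norm (1 / ap \<zeta>) \<le> B"
  proof -
    have "continuous_on (cball 0 1) (\<lambda>z. 1 / ap z)"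
      using ap \<delta> by (intro continuous_intros continuous_on_subset[OF holomorphic_on_imp_continuous_on[OF ap(1)]]) auto
    then have "bounded ((\<lambda>z. 1 / ap z) ` cball 0 1)"
      by (intro compact_imp_bounded compact_continuous_image) auto
    then show ?thesis by (auto simp: bounded_pos intro!: that)
  qed
  obtain C2 where C2: "C2 > 0" "\<And>n::nat. n \<ge> 1 \<Longrightarrow> \<sigma> powr (- (real n / 2)) \<le> C2 * (1 / real n powr \<alpha>)"
    using powr_decay_bound[OF W.\<sigma>] by metis
  obtain N where N: "\<And>n::nat. n \<ge> N \<Longrightarrow>
      norm1 p * W.Nb * norm1 m * norm1 c * \<sigma> powr (- real n) \<le> 1 / 2"
    using eventually_powr_small[OF W.\<sigma>] by metis
  define K1 where "K1 = norm1 c * (2 * (norm1 p * W.Nb * (1 + norm1 m * norm1 c)) + 1)"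
  have K1: "K1 \<ge> 0" unfolding K1_def
    by (intro mult_nonneg_nonneg add_nonneg_nonneg W.Nb_nonneg norm1_nonneg) auto
  define S where "S = (\<lambda>n z w. \<Sum>i<n. (\<Sum>j<n. V n i j * w ^ j) * (1 / z) ^ i)"
  define T where "T = (\<lambda>z w. z / (z - w) / (ap (1 / z) * am (1 / w)))"
  define E where "E = (\<lambda>(n::nat) (z::complex) (w::complex).
    1 / real n powr \<alpha> + norm w powr (real n / 2) + 1 / norm z powr (real n / 2))"
  define R where "R = (\<lambda>(z::complex) (w::complex). 1 / ((norm z - 1) * (1 - norm w)))"
  define isinv where "isinv = (\<lambda>n. \<forall>k<n. \<forall>j<n. (\<Sum>i<n. a (int k - int i) * V n i j) = (if k = j then 1 else 0))"
  define dom where "dom = (\<lambda>(z::complex) (w::complex). w \<noteq> 0 \<and> norm w < 1 \<and> 1 < norm z \<and> norm z < 1 + \<epsilon>)"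
  have E0: "E n z w \<ge> 0" for n z w by (simp add: E_def)
  have R0: "R z w \<ge> 0" if "dom z w" for z w using that by (simp add: R_def dom_def)
  \<comment> \<open>The left side is \<open>norm z / (norm z - 1)\<close>: the numerator is below
    \<open>1 + \<epsilon>\<close>, and a further division by \<open>1 - norm w \<le> 1\<close> only
    enlarges the bound.\<close>
  have fac: "1 / (1 - norm (1 / z)) \<le> (1 + \<epsilon>) * R z w" if "dom z w" for z w
  proof -
    have d: "norm w < 1" "1 < norm z" "norm z < 1 + \<epsilon>" "0 \<le> norm w" using that by (auto simp: dom_def)
    then have "z \<noteq> 0" by auto
    with d have "1 / (1 - norm (1 / z)) = norm z * (1 / (norm z - 1))"
      by (simp add: norm_divide field_simps)
    also have "\<dots> \<le> (1 + \<epsilon>) * (1 / (norm z - 1))" using d by (intro mult_right_mono) auto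
    also have "\<dots> \<le> (1 + \<epsilon>) * R z w" unfolding R_def
      using d \<epsilon> by (intro mult_left_mono divide_left_mono) (auto simp: mult_left_le)
    finally show ?thesis .
  qed
  \<comment> \<open>Lets a quantity that is merely bounded be charged to \<open>R\<close>.\<close>
  have one_le: "1 \<le> \<epsilon> * R z w" if "dom z w" for z w
  proof -
    have d: "norm w < 1" "1 < norm z" "norm z < 1 + \<epsilon>" "0 \<le> norm w" using that by (auto simp: dom_def)
    then have "(norm z - 1) * (1 - norm w) \<le> \<epsilon> * 1" by (intro mult_mono) auto
    then show ?thesis using d by (simp add: R_def)
  qed
  have T_eq: "T z w = 1 / am (1 / w) / (1 - w * (1 / z)) * (1 / ap (1 / z))" if "dom z w" for z w
  proof -
    have "z \<noteq> 0" "z \<noteq> w" using that by (auto simp: dom_def)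
    then have e: "z / (z - w) = 1 / (1 - w * (1 / z))" by (simp add: field_simps)
    have "T z w = z / (z - w) * (1 / am (1 / w)) * (1 / ap (1 / z))" by (simp add: T_def mult_ac)
    then show ?thesis unfolding e by (simp add: mult_ac)
  qed
  have z_lt: "norm (1 / z) < 1" if "dom z w" for z w
    using that by (auto simp: dom_def norm_divide divide_less_eq)
  have ap_nz: "ap (1 / z) \<noteq> 0" "norm (1 / ap (1 / z)) \<le> B" if "dom z w" for z w
  proof -
    have "norm (1 / z) \<le> 1" using z_lt[OF that] by simp
    then show "ap (1 / z) \<noteq> 0" "norm (1 / ap (1 / z)) \<le> B" using ap(2) \<delta> B by auto
  qed
  \<comment> \<open>\<open>B\<close> pays for the division by \<open>ap (1 / z)\<close>,
    \<open>K1\<close> is the constant of the generating function estimate, \<open>C2 + 1\<close>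
    compares its error \<open>e\<close> with \<open>E\<close>, and \<open>1 + \<epsilon>\<close>
    comes from \<open>fac\<close>.\<close>
  define C1 where "C1 = B * K1 * (C2 + 1) * (1 + \<epsilon>)"
  have large: "norm (S n z w - T z w) \<le> C1 * (R z w * E n z w)"
    if n: "n \<ge> 1" "n \<ge> N" and i: "isinv n" and d: "dom z w" for n z w
  proof -
    define \<zeta> where "\<zeta> = 1 / z"
    have \<zeta>: "\<zeta> \<noteq> 0" "norm \<zeta> < 1" using d z_lt[OF d] by (auto simp: \<zeta>_def dom_def)
    have w: "w \<noteq> 0" "norm w < 1" using d by (auto simp: dom_def)
    define e where "e = \<sigma> powr (- (real n / 2)) + norm w powr (real n / 2)"
    have solve: "(\<Sum>i<n. a (k - int i) * (\<Sum>j<n. V n i j * w ^ j)) = w powi k" if k: "0 \<le> k" "k < int n" for k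
    proof -
      obtain k' where k': "k = int k'" "k' < n" using k by (metis nonneg_int_cases of_nat_less_iff)
      have "(\<Sum>i<n. a (k - int i) * (\<Sum>j<n. V n i j * w ^ j))
          = (\<Sum>i<n. \<Sum>j<n. a (k - int i) * V n i j * w ^ j)"
        by (simp add: sum_distrib_left mult.assoc)
      also have "\<dots> = (\<Sum>j<n. \<Sum>i<n. a (k - int i) * V n i j * w ^ j)" by (rule sum.swap)
      also have "\<dots> = (\<Sum>j<n. (\<Sum>i<n. a (k - int i) * V n i j) * w ^ j)" by (simp add: sum_distrib_right)
      also have "\<dots> = (\<Sum>j<n. if k' = j then w ^ j else 0)"
        using i k' by (intro sum.cong) (auto simp: isinv_def)
      also have "\<dots> = w powi k" using k' by simp
      finally show ?thesis .
    qed
    have "norm (ap \<zeta> * (\<Sum>i<n. (\<Sum>j<n. V n i j * w ^ j) * \<zeta> ^ i) - 1 / am (1 / w) / (1 - w * \<zeta>))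
        \<le> K1 * e / (1 - norm \<zeta>)"
      unfolding K1_def e_def
      by (rule W.generating_function_estimate[OF w solve N[OF n(2)] \<zeta> p_sum[OF \<zeta>] c_sum[OF w]])
    moreover have "S n z w - T z w =
        1 / ap \<zeta> * (ap \<zeta> * (\<Sum>i<n. (\<Sum>j<n. V n i j * w ^ j) * \<zeta> ^ i) - 1 / am (1 / w) / (1 - w * \<zeta>))"
    proof -
      have alg: "x - y * (1 / u) = 1 / u * (u * x - y)" if "u \<noteq> 0" for u x y :: complex
        using that by (simp add: field_simps)
      show ?thesis unfolding T_eq[OF d] S_def \<zeta>_def by (rule alg[OF ap_nz(1)[OF d]])
    qed
    ultimately have "norm (S n z w - T z w) \<le> B * (K1 * e / (1 - norm \<zeta>))"
      using ap_nz(2)[OF d] B(1) by (simp only: norm_mult) (intro mult_mono, auto simp: \<zeta>_def)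
    also have "\<dots> = B * K1 * (e * (1 / (1 - norm (1 / z))))" by (simp add: \<zeta>_def)
    also have "\<dots> \<le> B * K1 * (((C2 + 1) * E n z w) * ((1 + \<epsilon>) * R z w))"
    proof (intro mult_left_mono mult_mono)
      have "\<sigma> powr (- (real n / 2)) \<le> C2 * (1 / real n powr \<alpha>)" by (rule C2(2)[OF n(1)])
      also have "\<dots> \<le> C2 * E n z w" using C2(1) by (intro mult_left_mono) (auto simp: E_def)
      moreover have "norm w powr (real n / 2) \<le> E n z w" by (simp add: E_def)
      ultimately show "e \<le> (C2 + 1) * E n z w" by (simp add: e_def algebra_simps)
      show "1 / (1 - norm (1 / z)) \<le> (1 + \<epsilon>) * R z w" by (rule fac[OF d])
    qed (use B K1 C2 E0 d \<zeta> in \<open>auto simp: \<zeta>_def\<close>)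
    finally show ?thesis by (simp add: C1_def mult_ac)
  qed
  \<comment> \<open>For the finitely many \<open>n < N\<close> only a bound depending on \<open>n\<close> is available, and it suffices.\<close>
  define D where "D = (\<lambda>n. (\<epsilon> * (\<Sum>i<n. \<Sum>j<n. norm (V n i j)) + B * norm1 c * (1 + \<epsilon>)) * real n powr \<alpha>)"
  have D0: "D n \<ge> 0" for n unfolding D_def
    using \<epsilon> B(1) by (intro mult_nonneg_nonneg add_nonneg_nonneg sum_nonneg norm1_nonneg) auto
  have small: "norm (S n z w - T z w) \<le> D n * (R z w * E n z w)" if n: "n \<ge> 1" and d: "dom z w" for n z w
  proof -
    have w: "w \<noteq> 0" "norm w < 1" using d by (auto simp: dom_def)
    have z: "norm (1 / z) < 1" by (rule z_lt[OF d])
    have "norm (S n z w) \<le> (\<Sum>i<n. \<Sum>j<n. norm (V n i j))"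
      unfolding S_def
    proof (rule sum_norm_le)
      fix i
      have "norm (\<Sum>j<n. V n i j * w ^ j) \<le> (\<Sum>j<n. norm (V n i j))"
        using w by (intro sum_norm_le) (simp add: norm_mult norm_power mult_left_le power_le_one)
      moreover have "norm ((1 / z) ^ i) \<le> 1" using z by (simp add: norm_power power_le_one)
      ultimately show "norm ((\<Sum>j<n. V n i j * w ^ j) * (1 / z) ^ i) \<le> (\<Sum>j<n. norm (V n i j))"
        unfolding norm_mult by (smt (verit) mult_left_le norm_ge_zero)
    qed
    also have "\<dots> * 1 \<le> (\<Sum>i<n. \<Sum>j<n. norm (V n i j)) * (\<epsilon> * R z w)"
      by (intro mult_left_mono one_le[OF d] sum_nonneg) auto
    finally have 1: "norm (S n z w) \<le> (\<epsilon> * (\<Sum>i<n. \<Sum>j<n. norm (V n i j))) * R z w" by (simp add: mult_ac)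
    \<comment> \<open>As \<open>norm w < 1\<close>, the denominator is no smaller than the one that
      \<open>fac\<close> handles.\<close>
    have "1 - norm (1 / z) \<le> norm (1 - w * (1 / z))"
    proof -
      have "norm (w * (1 / z)) \<le> norm (1 / z)"
        using w unfolding norm_mult by (intro mult_left_le_one_le) auto
      then show ?thesis using norm_triangle_ineq2[of 1 "w * (1 / z)"] by simp
    qed
    then have "1 / norm (1 - w * (1 / z)) \<le> 1 / (1 - norm (1 / z))"
      using z by (intro divide_left_mono mult_pos_pos) auto
    also have "\<dots> \<le> (1 + \<epsilon>) * R z w" by (rule fac[OF d])
    finally have "norm (1 / am (1 / w)) * (1 / norm (1 - w * (1 / z))) * norm (1 / ap (1 / z))
        \<le> norm1 c * ((1 + \<epsilon>) * R z w) * B"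
      using c_le[OF w] ap_nz(2)[OF d] B(1) norm1_nonneg[of c] R0[OF d] \<epsilon> by (intro mult_mono) auto
    then have 2: "norm (T z w) \<le> B * norm1 c * (1 + \<epsilon>) * R z w"
      unfolding T_eq[OF d] by (simp add: norm_mult norm_divide mult_ac)
    have "norm (S n z w - T z w) \<le> (\<epsilon> * (\<Sum>i<n. \<Sum>j<n. norm (V n i j)) + B * norm1 c * (1 + \<epsilon>)) * R z w * 1"
      using 1 2 norm_triangle_ineq4[of "S n z w" "T z w"] by (simp add: algebra_simps)
    \<comment> \<open>\<open>E\<close> contains \<open>1 / real n powr \<alpha>\<close>, so the
      factor \<open>real n powr \<alpha>\<close> in \<open>D\<close> makes up for the absent
      decay.\<close>
    also have "\<dots> \<le> (\<epsilon> * (\<Sum>i<n. \<Sum>j<n. norm (V n i j)) + B * norm1 c * (1 + \<epsilon>)) * R z w * (real n powr \<alpha> * E n z w)"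
    proof (rule mult_left_mono)
      have "1 = real n powr \<alpha> * (1 / real n powr \<alpha>)" using n by simp
      also have "\<dots> \<le> real n powr \<alpha> * E n z w" by (intro mult_left_mono) (auto simp: E_def)
      finally show "1 \<le> real n powr \<alpha> * E n z w" .
      show "0 \<le> (\<epsilon> * (\<Sum>i<n. \<Sum>j<n. norm (V n i j)) + B * norm1 c * (1 + \<epsilon>)) * R z w"
        using \<epsilon> B(1) R0[OF d] by (intro mult_nonneg_nonneg add_nonneg_nonneg sum_nonneg norm1_nonneg) auto
    qed
    finally show ?thesis by (simp add: D_def mult_ac)
  qed
  have C1: "C1 \<ge> 0" unfolding C1_def using B K1 C2 \<epsilon> by simp
  \<comment> \<open>The sum of the nonnegative \<open>D n\<close> stands in for their
    maximum.\<close>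
  have "norm (S n z w - T z w) \<le> (C1 + (\<Sum>n<N. D n)) * (R z w * E n z w)"
    if n: "n \<ge> 1" and i: "isinv n" and d: "dom z w" for n z w
  proof -
    have RE: "0 \<le> R z w * E n z w" using R0[OF d] E0 by simp
    show ?thesis
    proof (cases "n \<ge> N")
      case True
      show ?thesis
        by (rule order_trans[OF large[OF n True i d] mult_right_mono[OF _ RE]]) (simp add: D0 sum_nonneg)
    next
      case False
      then have "D n \<le> (\<Sum>n<N. D n)" by (intro member_le_sum) (auto simp: D0)
      then show ?thesis
        by (intro order_trans[OF small[OF n d] mult_right_mono[OF _ RE]]) (use C1 in simp)
    qed
  qed
  then show ?thesis
    unfolding S_def T_def R_def E_def dom_def isinv_def a_def by blast
qed

section \<open>The kernel and its generating function\<close>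

text \<open>Summability of complex families is absolute, so the product family is dominated by a
  product of summable norms and iterated summation gives its value.\<close>

lemma has_sum_mult_pairs:
  fixes f :: "'a \<Rightarrow> complex" and g :: "'b \<Rightarrow> complex"
  assumes f: "(f has_sum a) A" and g: "(g has_sum b) B"
  shows "((\<lambda>(x, y). f x * g y) has_sum (a * b)) (A \<times> B)"
proof (rule has_sum_SigmaI)
  show "((\<lambda>y. case (x, y) of (x, y) \<Rightarrow> f x * g y) has_sum (f x * b)) B" for x
    using has_sum_cmult_right[OF g] by simp
  show "((\<lambda>x. f x * b) has_sum (a * b)) A" by (rule has_sum_cmult_left[OF f])
  have f': "(\<lambda>x. norm (f x)) summable_on A" and g': "(\<lambda>x. norm (g x)) summable_on B"
    using f g summable_on_iff_abs_summable_on_complex has_sum_imp_summable by metis+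
  have "(\<lambda>(x, y). norm (f x) * norm (g y)) summable_on (A \<times> B)"
  proof (rule summable_on_SigmaI)
    show "((\<lambda>y. case (x, y) of (x, y) \<Rightarrow> norm (f x) * norm (g y)) has_sum
        (norm (f x) * infsum (\<lambda>y. norm (g y)) B)) B" for x
      using has_sum_cmult_right[OF has_sum_infsum[OF g']] by simp
    show "(\<lambda>x. norm (f x) * infsum (\<lambda>y. norm (g y)) B) summable_on A"
      by (rule summable_on_cmult_left[OF f'])
  qed auto
  then show "(\<lambda>(x, y). f x * g y) summable_on (A \<times> B)"
    by (rule infsum_norm_bound(1)) (auto simp: norm_mult)
qed

text \<open>With \<open>k = e - x\<close> the weight \<open>z powi x\<close> is
  \<open>z powi e * (1 / z) powi k\<close>, whence the evaluation of the symbols at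
  \<open>1 / z\<close>.\<close>

lemma fourier_row_has_sum:
  assumes h: "h holomorphic_on {u. r1 < norm u \<and> norm u < r2}" "r1 < 1" "1 < r2"
    and z: "z \<noteq> 0" "r1 < norm (1 / z)" "norm (1 / z) < r2"
  shows "((\<lambda>x. fourier_coeff h (e - x) * z powi x) has_sum (z powi e * h (1 / z))) UNIV"
proof -
  have "((\<lambda>k. z powi e * (fourier_coeff h k * (1 / z) powi k)) has_sum (z powi e * h (1 / z))) UNIV"
    by (intro has_sum_cmult_right laurent_has_sum[OF h]) (use z in auto)
  moreover have "((\<lambda>x. fourier_coeff h (e - x) * z powi x) has_sum (z powi e * h (1 / z))) UNIV \<longleftrightarrow>
    ((\<lambda>k. z powi e * (fourier_coeff h k * (1 / z) powi k)) has_sum (z powi e * h (1 / z))) UNIV"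
  proof (rule has_sum_reindex_bij_witness[where i = "\<lambda>k. e - k" and j = "\<lambda>x. e - x"])
    fix x
    have "z powi x = z powi e * z powi (- (e - x))"
      using z power_int_add[of z e "- (e - x)"] by simp
    also have "z powi (- (e - x)) = (1 / z) powi (e - x)"
      by (simp only: power_int_minus power_int_divide_distrib power_int_1_left divide_inverse mult_1 power_int_inverse)
    finally show "z powi e * (fourier_coeff h (e - x) * (1 / z) powi (e - x)) = fourier_coeff h (e - x) * z powi x"
      by simp
  qed auto
  ultimately show ?thesis by simp
qed

lemma fourier_column_has_sum:
  assumes h: "h holomorphic_on {u. r1 < norm u \<and> norm u < r2}" "r1 < 1" "1 < r2"
    and w: "w \<noteq> 0" "r1 < norm (1 / w)" "norm (1 / w) < r2"
  shows "((\<lambda>y. fourier_coeff h (y - e) * w powi (- y)) has_sum (w powi (- e) * h (1 / w))) UNIV"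
proof -
  have "((\<lambda>y. fourier_coeff h (y - e) * w powi (- y)) has_sum (w powi (- e) * h (1 / w))) UNIV \<longleftrightarrow>
    ((\<lambda>x. fourier_coeff h (- e - x) * w powi x) has_sum (w powi (- e) * h (1 / w))) UNIV"
    by (rule has_sum_reindex_bij_witness[where i = uminus and j = uminus]) auto
  with fourier_row_has_sum[OF h w, of "- e"] show ?thesis by simp
qed

abbreviation toep_inv :: "(int \<Rightarrow> complex \<Rightarrow> complex) \<Rightarrow> int \<Rightarrow> nat \<Rightarrow> nat \<Rightarrow> nat \<Rightarrow> complex" where
  "toep_inv f M n i j \<equiv> the (mat_inverse (toepA f M n)) $$ (i, j)"

lemma toep_inv_right_inverse:
  assumes det: "Determinant.det (toepA f M n) \<noteq> 0" and kj: "k < n" "j < n"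
  shows "(\<Sum>i<n. fourier_coeff (fprod f (- M) M) (int k - int i) * toep_inv f M n i j) = (if k = j then 1 else 0)"
proof -
  have A: "toepA f M n \<in> carrier_mat n n" by (simp add: toepA_def)
  obtain B where B: "mat_inverse (toepA f M n) = Some B"
    using mat_inverse(1)[OF A, of "()"] det_non_zero_imp_unit[OF A det, of "()"] by (cases "mat_inverse (toepA f M n)") auto
  have AB: "toepA f M n * B = 1\<^sub>m n" and Bc: "B \<in> carrier_mat n n" using mat_inverse(2)[OF A B] by auto
  have "(if k = j then 1 else 0) = (toepA f M n * B) $$ (k, j)" unfolding AB using kj by simp
  also have "\<dots> = (\<Sum>i = 0..<n. toepA f M n $$ (k, i) * B $$ (i, j))"
    using kj A Bc by (auto simp: scalar_prod_def)
  \<comment> \<open>The index is \<open>endpoint (Suc i) - endpoint (Suc k)\<close>, that is k -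
    i.\<close>
  also have "\<dots> = (\<Sum>i<n. fourier_coeff (fprod f (- M) M) (int k - int i) * B $$ (i, j))"
    using kj by (intro sum.cong) (auto simp: toepA_def phi_def endpoint_def)
  finally show ?thesis using B by simp
qed

text \<open>The kernel is a finite combination of products of a function of \<open>x\<close> and one
  of \<open>y\<close>, so the double series factors.\<close>

lemma Kgen_term_has_sum:
  assumes row: "\<And>e. ((\<lambda>x. fourier_coeff (fprod f r M) (e - x) * z powi x) has_sum (z powi e * F1)) UNIV"
    and col: "\<And>e. ((\<lambda>y. fourier_coeff (fprod f (- M) s) (y - e) * w powi (- y)) has_sum (w powi (- e) * F2)) UNIV"
  shows "(Kgen_term f M n r s z w has_sum
    (F1 * F2 * (\<Sum>i<n. (\<Sum>j<n. toep_inv f M n i j * w ^ j) * (1 / z) ^ i))) UNIV"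
proof -
  \<comment> \<open>\<open>endpoint (Suc i)\<close> is -i, which yields polynomials in
    \<open>1 / z\<close> and in \<open>w\<close>.\<close>
  have e: "z powi endpoint (Suc i) = (1 / z) ^ i" "w powi (- endpoint (Suc i)) = w ^ i" for i
    by (auto simp: endpoint_def power_int_minus power_one_over inverse_eq_divide)
  have "((\<lambda>p. \<Sum>i<n. \<Sum>j<n. (\<lambda>(x, y). (fourier_coeff (fprod f r M) (endpoint (Suc i) - x) * z powi x) *
      (fourier_coeff (fprod f (- M) s) (y - endpoint (Suc j)) * w powi (- y))) p * toep_inv f M n i j) has_sum
      (\<Sum>i<n. \<Sum>j<n. z powi endpoint (Suc i) * F1 * (w powi (- endpoint (Suc j)) * F2) * toep_inv f M n i j))
      (UNIV \<times> UNIV)"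
    by (intro has_sum_sum has_sum_cmult_left has_sum_mult_pairs row col)
  moreover have "(\<lambda>p. \<Sum>i<n. \<Sum>j<n. (\<lambda>(x, y). (fourier_coeff (fprod f r M) (endpoint (Suc i) - x) * z powi x) *
      (fourier_coeff (fprod f (- M) s) (y - endpoint (Suc j)) * w powi (- y))) p * toep_inv f M n i j)
      = Kgen_term f M n r s z w"
    by (auto simp: fun_eq_iff Kgen_term_def Ktilde_def phi_def sum.atLeast1_atMost_eq sum_distrib_left
      sum_distrib_right mult_ac)
  moreover have "(\<Sum>i<n. \<Sum>j<n. z powi endpoint (Suc i) * F1 * (w powi (- endpoint (Suc j)) * F2) * toep_inv f M n i j)
      = F1 * F2 * (\<Sum>i<n. (\<Sum>j<n. toep_inv f M n i j * w ^ j) * (1 / z) ^ i)"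
    unfolding e by (simp add: sum_distrib_left sum_distrib_right mult_ac)
  ultimately show ?thesis by simp
qed

section \<open>The limit kernel in terms of the factor products\<close>

lemma fprod_eq_wh:
  assumes "\<And>t. t \<in> {r..<s} \<Longrightarrow> wiener_hopf (f t) (fp t) (fm t)"
  shows "fprod f r s z = (\<Prod>t\<in>{r..<s}. wh_plus (f t) (fp t) (fm t) z) * (\<Prod>t\<in>{r..<s}. wh_minus (f t) (fp t) (fm t) z)"
  unfolding fprod_def prod.distrib[symmetric]
  using assms by (intro prod.cong) (auto simp: wh_plus_times_wh_minus)

lemma prod_int_split:
  fixes r s t :: int
  assumes "r \<le> s" "s \<le> t"
  shows "(\<Prod>l\<in>{r..<t}. g l) = (\<Prod>l\<in>{r..<s}. g l) * (\<Prod>l\<in>{s..<t}. g l)"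
proof -
  have "{r..<t} = {r..<s} \<union> {s..<t}" using assms by auto
  then show ?thesis by (simp add: prod.union_disjoint)
qed

lemma wh_plus_nonzero: "wiener_hopf f fp fm \<Longrightarrow> norm z \<le> 1 \<Longrightarrow> wh_plus f fp fm z \<noteq> 0"
  by (auto simp: wiener_hopf_def wh_plus_def)

lemma wh_minus_nonzero: "wiener_hopf f fp fm \<Longrightarrow> norm z \<ge> 1 \<Longrightarrow> wh_minus f fp fm z \<noteq> 0"
  by (auto simp: wiener_hopf_def wh_minus_def)

text \<open>With the same prefactors as in the finite kernel split off, what remains involves only
  the full products of the factors and no longer \<open>r\<close> or \<open>s\<close>; one Toeplitz
  estimate thus serves all pairs. The cancelled products are nonzero because \<open>1 / z\<close>
  and \<open>1 / w\<close> lie on the zero-free sides.\<close>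

lemma Kinf_eq:
  assumes wh: "\<And>t. t \<in> {- M..<M} \<Longrightarrow> wiener_hopf (f t) (fp t) (fm t)"
    and rs: "- M \<le> r" "r \<le> M" "- M \<le> s" "s \<le> M"
    and z: "norm (1 / z) \<le> 1" and w: "norm (1 / w) \<ge> 1"
  shows "Kinf f fp fm M r s z w = fprod f r M (1 / z) * fprod f (- M) s (1 / w) *
    (z / (z - w) / ((\<Prod>t\<in>{- M..<M}. wh_plus (f t) (fp t) (fm t) (1 / z)) *
      (\<Prod>t\<in>{- M..<M}. wh_minus (f t) (fp t) (fm t) (1 / w))))"
proof -
  let ?p = "\<lambda>A z. \<Prod>t\<in>A. wh_plus (f t) (fp t) (fm t) z" and ?m = "\<lambda>A z. \<Prod>t\<in>A. wh_minus (f t) (fp t) (fm t) z"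
  have F: "fprod f r M (1 / z) = ?p {r..<M} (1 / z) * ?m {r..<M} (1 / z)"
    "fprod f (- M) s (1 / w) = ?p {- M..<s} (1 / w) * ?m {- M..<s} (1 / w)"
    by (rule fprod_eq_wh; use wh rs in force)+
  have "wh_plus (f t) (fp t) (fm t) (1 / z) \<noteq> 0" "wh_minus (f t) (fp t) (fm t) (1 / w) \<noteq> 0"
    if "t \<in> {- M..<M}" for t
    using wh_plus_nonzero[OF wh[OF that] z] wh_minus_nonzero[OF wh[OF that] w] by auto
  then have "?p {r..<M} (1 / z) \<noteq> 0" "?m {- M..<s} (1 / w) \<noteq> 0"
    using rs by auto
  moreover have "c * (m1 * p2 / (p3 * m4)) = p1 * m1 * (p2 * m2) * (c / (p3 * p1 * (m2 * m4)))"
    if "p1 \<noteq> 0" "m2 \<noteq> 0" for c m1 p2 p3 m4 p1 m2 :: complex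
    using that by (simp add: divide_simps)
  ultimately show ?thesis
    unfolding Kinf_def Gfun_def F prod_int_split[OF rs(1,2), of "\<lambda>t. wh_plus (f t) (fp t) (fm t) (1 / z)"]
      prod_int_split[OF rs(3,4), of "\<lambda>t. wh_minus (f t) (fp t) (fm t) (1 / w)"]
    by blast
qed

text \<open>On the diagonal the plus products cancel below \<open>r\<close> and the minus products
  from \<open>s\<close> on, which leaves both factors over \<open>{r..<s}\<close>.\<close>

lemma Gfun_diag:
  assumes wh: "\<And>t. t \<in> {- M..<M} \<Longrightarrow> wiener_hopf (f t) (fp t) (fm t)"
    and rs: "- M \<le> r" "r \<le> s" "s \<le> M" and z: "norm (1 / z) = 1"
  shows "Gfun f fp fm M r s z z = fprod f r s (1 / z)"
proof -
  let ?p = "\<lambda>A z. \<Prod>t\<in>A. wh_plus (f t) (fp t) (fm t) z" and ?m = "\<lambda>A z. \<Prod>t\<in>A. wh_minus (f t) (fp t) (fm t) z"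
  have F: "fprod f r s (1 / z) = ?p {r..<s} (1 / z) * ?m {r..<s} (1 / z)"
    by (rule fprod_eq_wh; use wh rs in force)
  have "wh_plus (f t) (fp t) (fm t) (1 / z) \<noteq> 0" "wh_minus (f t) (fp t) (fm t) (1 / z) \<noteq> 0"
    if "t \<in> {- M..<M}" for t
    using wh_plus_nonzero[OF wh[OF that]] wh_minus_nonzero[OF wh[OF that]] z by auto
  then have "?p {- M..<r} (1 / z) \<noteq> 0" "?m {s..<M} (1 / z) \<noteq> 0"
    using rs by auto
  then show ?thesis
    unfolding Gfun_def F prod_int_split[OF rs(1,2)] prod_int_split[OF rs(2,3)]
    by (simp add: divide_simps)
qed

text \<open>On the circle \<open>1 / z\<close> is the conjugate point, so the integrand is the
  Fourier integrand reflected in \<open>\<theta>\<close>.\<close>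

lemma phi_eq_integral:
  assumes wh: "\<And>t. t \<in> {- M..<M} \<Longrightarrow> wiener_hopf (f t) (fp t) (fm t)"
    and rs: "- M \<le> r" "r \<le> s" "s \<le> M"
  shows "phi f r s x y = 1 / (2 * of_real pi) *
    integral {-pi..pi} (\<lambda>\<theta>. cis (of_int (y - x) * \<theta>) * Gfun f fp fm M r s (cis \<theta>) (cis \<theta>))"
proof -
  let ?g = "\<lambda>\<theta>. fprod f r s (cis \<theta>) * cis (- (of_int (y - x) * \<theta>))"
  have "integral {-pi..pi} (\<lambda>\<theta>. cis (of_int (y - x) * \<theta>) * Gfun f fp fm M r s (cis \<theta>) (cis \<theta>))
      = integral {-pi..pi} (\<lambda>\<theta>. ?g (- \<theta>))"
  proof (rule integral_cong)
    fix \<theta> :: real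
    have i: "1 / cis \<theta> = cis (- \<theta>)" by (simp add: divide_inverse)
    have "Gfun f fp fm M r s (cis \<theta>) (cis \<theta>) = fprod f r s (cis (- \<theta>))"
      using Gfun_diag[where z = "cis \<theta>", OF wh rs] unfolding i by simp
    then show "cis (of_int (y - x) * \<theta>) * Gfun f fp fm M r s (cis \<theta>) (cis \<theta>) = ?g (- \<theta>)" by simp
  qed
  also have "\<dots> = integral {-pi..pi} ?g"
    using Henstock_Kurzweil_Integration.integral_reflect_real[of pi "-pi" ?g] by simp
  finally show ?thesis by (simp add: phi_def fourier_coeff_def)
qed

text \<open>\<open>C\<close> is chosen before \<open>n\<close>, \<open>r\<close>, \<open>s\<close>,
  \<open>z\<close> and \<open>w\<close>. As \<open>1 / norm w\<close> can exceed
  \<open>1 + \<epsilon>\<close>, analyticity up to that radius is asked for separately, for the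
  factors of f_{-M,s}. The clause \<open>w \<noteq> 0\<close> matters once
  \<open>\<epsilon> > 1\<close>. Summability accompanies the bound because a divergent
  \<open>Kgen\<close> would be 0 by convention.\<close>

theorem proposition1p8:
  fixes M :: int and f fp fm :: "int \<Rightarrow> complex \<Rightarrow> complex"
    and eps :: "int \<Rightarrow> real" and \<alpha> :: real
  assumes "M \<ge> 1"
    and "\<And>r. r \<in> {- M..<M} \<Longrightarrow> (\<lambda>\<theta>. f r (cis \<theta>)) absolutely_integrable_on {-pi..pi}"
    and "\<And>r. r \<in> {- M..<M} \<Longrightarrow> winding_number (f r \<circ> circlepath 0 1) 0 = 0"
    and "\<And>r. r \<in> {- M..<M} \<Longrightarrow> wiener_hopf (f r) (fp r) (fm r)"
    and "\<And>r. r \<in> {- M..<M} \<Longrightarrow> eps r > 0"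
    and "\<And>r. r \<in> {- M..<M} \<Longrightarrow> f r analytic_on {z. 1 - eps r < norm z \<and> norm z < 1 + eps r}"
    and "\<alpha> > 0"
    and "(\<lambda>k::int. \<bar>real_of_int k\<bar> powr \<alpha> * norm (fourier_coeff (fprod f (- M) M) k)) summable_on UNIV"
  defines "\<epsilon> \<equiv> Min (eps ` {- M..<M})"
  shows
    "(\<exists>C. \<forall>n\<ge>1. Determinant.det (toepA f M n) \<noteq> 0 \<longrightarrow>
        (\<forall>r s z w. - M < r \<and> r < M \<and> - M < s \<and> s < M \<and>
           1 - \<epsilon> < norm w \<and> norm w < 1 \<and> 1 < norm z \<and> norm z < 1 + \<epsilon> \<and>
           w \<noteq> 0 \<and>
           (\<forall>t\<in>{- M..<s}. f t analytic_on {u. 1 \<le> norm u \<and> norm u \<le> norm (1 / w)}) \<longrightarrow>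
             Kgen_term f M n r s z w summable_on UNIV \<and>
             norm (Kgen f M n r s z w - Kinf f fp fm M r s z w)
               \<le> C * (norm (fprod f r M (1 / z)) * norm (fprod f (- M) s (1 / w))
                        / ((norm z - 1) * (1 - norm w))
                      * (1 / real n powr \<alpha> + norm w powr (real n / 2)
                           + 1 / norm z powr (real n / 2)))))
     \<and> (\<forall>r s x y. - M < r \<and> r < s \<and> s < M \<longrightarrow>
          phi f r s x y =
            1 / (2 * of_real pi) *
              integral {-pi..pi}
                (\<lambda>\<theta>. cis (of_int (y - x) * \<theta>) * Gfun f fp fm M r s (cis \<theta>) (cis \<theta>)))"
proof (intro conjI allI impI)
  note wh = assms(4)
  show "phi f r s x y = 1 / (2 * of_real pi) *
     integral {-pi..pi} (\<lambda>\<theta>. cis (of_int (y - x) * \<theta>) * Gfun f fp fm M r s (cis \<theta>) (cis \<theta>))"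
    if "- M < r \<and> r < s \<and> s < M" for r s x y
    by (rule phi_eq_integral) (use wh that in auto)
  have "\<epsilon> \<in> eps ` {- M..<M}" unfolding \<epsilon>_def using \<open>M \<ge> 1\<close> by (intro Min_in) auto
  then have \<epsilon>: "\<epsilon> > 0" using assms(5) by auto
  have \<epsilon>_le: "\<epsilon> \<le> eps t" if "t \<in> {- M..<M}" for t unfolding \<epsilon>_def using that by (intro Min_le) auto
  let ?A = "{z. 1 - \<epsilon> < norm z \<and> norm z < 1 + \<epsilon>}"
  have f_hol: "f t holomorphic_on ?A" if "t \<in> {- M..<M}" for t
    by (rule holomorphic_on_subset[OF analytic_imp_holomorphic[OF assms(6)[OF that]]])
      (use \<epsilon>_le[OF that] in auto)
  have F_hol: "fprod f r s holomorphic_on ?A" if "- M \<le> r" "s \<le> M" for r s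
    unfolding fprod_def[abs_def] using that by (intro holomorphic_on_prod f_hol) auto
  define ap where "ap = (\<lambda>z. \<Prod>t\<in>{- M..<M}. wh_plus (f t) (fp t) (fm t) z)"
  define am where "am = (\<lambda>z. \<Prod>t\<in>{- M..<M}. wh_minus (f t) (fp t) (fm t) z)"
  have a: "fprod f (- M) M z = ap z * am z" for z
    unfolding ap_def am_def by (rule fprod_eq_wh) (use wh in auto)
  have a': "fprod f (- M) M = (\<lambda>z. ap z * am z)" using a by blast
  have ap_hol: "ap holomorphic_on {z. norm z < 1 + \<epsilon>}" unfolding ap_def
    by (intro holomorphic_on_prod wh_plus_holomorphic wh f_hol \<epsilon>)
  have am_hol: "am holomorphic_on {z. 1 - \<epsilon> < norm z}" unfolding am_def
    by (intro holomorphic_on_prod wh_minus_holomorphic wh f_hol \<epsilon>)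
  have ap_nz: "ap z \<noteq> 0" if "norm z \<le> 1" for z
    using wh that by (auto simp: ap_def wh_plus_nonzero)
  have am_nz: "am z \<noteq> 0" if "norm z \<ge> 1" for z
    using wh that by (auto simp: am_def wh_minus_nonzero)
  have "\<forall>t\<in>{- M..<M}. \<exists>L. L \<noteq> 0 \<and> (wh_minus (f t) (fp t) (fm t) \<longlongrightarrow> L) at_infinity"
    using wh wh_minus_tendsto by metis
  then obtain l where l: "\<And>t. t \<in> {- M..<M} \<Longrightarrow> l t \<noteq> 0"
    "\<And>t. t \<in> {- M..<M} \<Longrightarrow> (wh_minus (f t) (fp t) (fm t) \<longlongrightarrow> l t) at_infinity"
    by metis
  have am_lim: "(am \<longlongrightarrow> (\<Prod>t\<in>{- M..<M}. l t)) at_infinity"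
    unfolding am_def by (intro tendsto_prod l(2))
  have l_nz: "(\<Prod>t\<in>{- M..<M}. l t) \<noteq> 0" using l(1) by auto
  let ?F = "fprod f (- M) M"
  \<comment> \<open>Each factor is zero-free by assumption only on its own closed side. The product
    is nonzero on the circle, hence on a thin annulus around it, where neither continuation can
    vanish.\<close>
  have "open (?A \<inter> ?F -` (- {0}))"
    by (intro continuous_open_preimage holomorphic_on_imp_continuous_on F_hol open_annulus) auto
  moreover have "{z. 1 \<le> norm z \<and> norm z \<le> 1} \<subseteq> ?A \<inter> ?F -` (- {0})"
    using \<epsilon> ap_nz am_nz by (auto simp: a)
  ultimately obtain \<eta> where \<eta>: "\<eta> > 0" "{z. 1 - \<eta> < norm z \<and> norm z < 1 + \<eta>} \<subseteq> ?A \<inter> ?F -` (- {0})"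
    by (rule annulus_neighbourhood) auto
  define \<delta> where "\<delta> = min \<epsilon> \<eta>"
  have \<delta>: "\<delta> > 0" using \<epsilon> \<eta> by (simp add: \<delta>_def)
  have nz: "ap z * am z \<noteq> 0" if "1 - \<delta> < norm z" "norm z < 1 + \<delta>" for z
  proof -
    have "z \<in> ?A \<inter> ?F -` (- {0})" by (rule subsetD[OF \<eta>(2)]) (use that in \<open>auto simp: \<delta>_def\<close>)
    then show ?thesis by (simp add: a)
  qed
  have ap_nz': "ap z \<noteq> 0" if "norm z < 1 + \<delta>" for z
    using that nz[of z] ap_nz[of z] \<delta> by (cases "norm z \<le> 1") auto
  have am_nz': "am z \<noteq> 0" if "1 - \<delta> < norm z" for z
    using that nz[of z] am_nz[of z] \<delta> by (cases "norm z \<ge> 1") auto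
  \<comment> \<open>\<open>\<delta>\<close> governs the coefficients, \<open>\<epsilon>\<close> only
    the range of \<open>z\<close>; \<open>1 / z\<close> lies in the disc for all these
    \<open>z\<close>.\<close>
  have "\<exists>C. \<forall>n\<ge>1. (\<forall>k<n. \<forall>j<n. (\<Sum>i<n. fourier_coeff (\<lambda>z. ap z * am z) (int k - int i) * toep_inv f M n i j)
          = (if k = j then 1 else 0)) \<longrightarrow>
     (\<forall>z w. w \<noteq> 0 \<and> norm w < 1 \<and> 1 < norm z \<and> norm z < 1 + \<epsilon> \<longrightarrow>
       norm ((\<Sum>i<n. (\<Sum>j<n. toep_inv f M n i j * w ^ j) * (1 / z) ^ i) - z / (z - w) / (ap (1 / z) * am (1 / w)))
         \<le> C * (1 / ((norm z - 1) * (1 - norm w)) *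
             (1 / real n powr \<alpha> + norm w powr (real n / 2) + 1 / norm z powr (real n / 2))))"
    by (rule toeplitz_inverse_estimate[OF \<delta> _ ap_nz' _ am_nz' am_lim l_nz \<epsilon>])
      (auto simp: \<delta>_def intro: holomorphic_on_subset[OF ap_hol] holomorphic_on_subset[OF am_hol])
  then obtain C where C0: "\<forall>n\<ge>1. (\<forall>k<n. \<forall>j<n. (\<Sum>i<n. fourier_coeff (\<lambda>z. ap z * am z) (int k - int i) * toep_inv f M n i j)
          = (if k = j then 1 else 0)) \<longrightarrow>
     (\<forall>z w. w \<noteq> 0 \<and> norm w < 1 \<and> 1 < norm z \<and> norm z < 1 + \<epsilon> \<longrightarrow>
       norm ((\<Sum>i<n. (\<Sum>j<n. toep_inv f M n i j * w ^ j) * (1 / z) ^ i) - z / (z - w) / (ap (1 / z) * am (1 / w)))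
         \<le> C * (1 / ((norm z - 1) * (1 - norm w)) *
             (1 / real n powr \<alpha> + norm w powr (real n / 2) + 1 / norm z powr (real n / 2))))" ..
  have inv: "\<forall>k<n. \<forall>j<n. (\<Sum>i<n. fourier_coeff (\<lambda>z. ap z * am z) (int k - int i) * toep_inv f M n i j)
          = (if k = j then 1 else 0)" if "Determinant.det (toepA f M n) \<noteq> 0" for n
    using toep_inv_right_inverse[OF that] unfolding a' by blast
  have C: "\<And>n z w. n \<ge> 1 \<Longrightarrow> Determinant.det (toepA f M n) \<noteq> 0 \<Longrightarrow>
     w \<noteq> 0 \<Longrightarrow> norm w < 1 \<Longrightarrow> 1 < norm z \<Longrightarrow> norm z < 1 + \<epsilon> \<Longrightarrow>
       norm ((\<Sum>i<n. (\<Sum>j<n. toep_inv f M n i j * w ^ j) * (1 / z) ^ i) - z / (z - w) / (ap (1 / z) * am (1 / w)))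
         \<le> C * (1 / ((norm z - 1) * (1 - norm w)) *
             (1 / real n powr \<alpha> + norm w powr (real n / 2) + 1 / norm z powr (real n / 2)))"
    using C0 inv by simp
  show "\<exists>C. \<forall>n\<ge>1. Determinant.det (toepA f M n) \<noteq> 0 \<longrightarrow>
        (\<forall>r s z w. - M < r \<and> r < M \<and> - M < s \<and> s < M \<and>
           1 - \<epsilon> < norm w \<and> norm w < 1 \<and> 1 < norm z \<and> norm z < 1 + \<epsilon> \<and>
           w \<noteq> 0 \<and>
           (\<forall>t\<in>{- M..<s}. f t analytic_on {u. 1 \<le> norm u \<and> norm u \<le> norm (1 / w)}) \<longrightarrow>
             Kgen_term f M n r s z w summable_on UNIV \<and>
             norm (Kgen f M n r s z w - Kinf f fp fm M r s z w)
               \<le> C * (norm (fprod f r M (1 / z)) * norm (fprod f (- M) s (1 / w))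
                        / ((norm z - 1) * (1 - norm w))
                      * (1 / real n powr \<alpha> + norm w powr (real n / 2)
                           + 1 / norm z powr (real n / 2))))"
  proof (intro exI[of _ C] allI impI)
    fix n :: nat and r s :: int and z w :: complex
    assume n: "1 \<le> n" and det: "Determinant.det (toepA f M n) \<noteq> 0"
    assume "- M < r \<and> r < M \<and> - M < s \<and> s < M \<and>
           1 - \<epsilon> < norm w \<and> norm w < 1 \<and> 1 < norm z \<and> norm z < 1 + \<epsilon> \<and> w \<noteq> 0 \<and>
           (\<forall>t\<in>{- M..<s}. f t analytic_on {u. 1 \<le> norm u \<and> norm u \<le> norm (1 / w)})"
    then have rs: "- M \<le> r" "r \<le> M" "- M \<le> s" "s \<le> M" and w: "norm w < 1" "w \<noteq> 0"
      and z: "1 < norm z" "norm z < 1 + \<epsilon>"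
      and an: "\<And>t. t \<in> {- M..<s} \<Longrightarrow> f t analytic_on {u. 1 \<le> norm u \<and> norm u \<le> norm (1 / w)}"
      by auto
    let ?F1 = "fprod f r M" and ?F2 = "fprod f (- M) s"
    have z0: "z \<noteq> 0" using z by auto
    have z': "norm (1 / z) < 1" using z by (auto simp: norm_divide divide_less_eq)
    \<comment> \<open>The row series is summed at \<open>1 / z\<close>, which must stay in the
      annulus of analyticity; this follows from
      \<open>(1 - \<epsilon>) * (1 + \<epsilon>) < 1\<close>.\<close>
    have z'': "1 - \<epsilon> < norm (1 / z)"
    proof -
      have "(1 - \<epsilon>) * norm z \<le> (1 - \<epsilon>) * (1 + \<epsilon>)" if "\<epsilon> \<le> 1"
        using that z by (intro mult_left_mono) auto
      moreover have "(1 - \<epsilon>) * (1 + \<epsilon>) < 1" using \<epsilon> by (simp add: algebra_simps)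
      moreover have "(1 - \<epsilon>) * norm z \<le> 0" if "\<epsilon> > 1"
        using that by (intro mult_nonpos_nonneg) auto
      ultimately have "(1 - \<epsilon>) * norm z < 1" by linarith
      then show ?thesis using z0 by (simp add: norm_divide pos_less_divide_eq)
    qed
    have w': "1 < norm (1 / w)" using w by (auto simp: norm_divide less_divide_eq)
    have row: "((\<lambda>x. fourier_coeff ?F1 (e - x) * z powi x) has_sum (z powi e * ?F1 (1 / z))) UNIV" for e
      by (rule fourier_row_has_sum[OF F_hol]) (use rs \<epsilon> z0 z' z'' in auto)
    \<comment> \<open>The annulus \<open>?A\<close> need not reach \<open>1 / w\<close>; the column
      series needs an open annulus containing both the circle and that point.\<close>
    have "?F2 analytic_on {u. 1 \<le> norm u \<and> norm u \<le> norm (1 / w)}"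
      unfolding fprod_def[abs_def] by (intro analytic_on_prod an)
    then obtain U where U: "open U" "{u. 1 \<le> norm u \<and> norm u \<le> norm (1 / w)} \<subseteq> U" "?F2 holomorphic_on U"
      by (auto simp: analytic_on_holomorphic)
    obtain \<kappa> where \<kappa>: "\<kappa> > 0" "{u. 1 - \<kappa> < norm u \<and> norm u < norm (1 / w) + \<kappa>} \<subseteq> U"
      by (rule annulus_neighbourhood[OF U(1,2)]) (use w' in auto)
    have col: "((\<lambda>y. fourier_coeff ?F2 (y - e) * w powi (- y)) has_sum (w powi (- e) * ?F2 (1 / w))) UNIV" for e
      by (rule fourier_column_has_sum[OF holomorphic_on_subset[OF U(3) \<kappa>(2)]]) (use w w' \<kappa> in auto)
    define S where "S = (\<Sum>i<n. (\<Sum>j<n. toep_inv f M n i j * w ^ j) * (1 / z) ^ i)"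
    define T where "T = z / (z - w) / (ap (1 / z) * am (1 / w))"
    have K: "(Kgen_term f M n r s z w has_sum (?F1 (1 / z) * ?F2 (1 / w) * S)) UNIV"
      unfolding S_def by (rule Kgen_term_has_sum[OF row col])
    have "Kinf f fp fm M r s z w = ?F1 (1 / z) * ?F2 (1 / w) * T"
      unfolding T_def ap_def am_def by (rule Kinf_eq) (use wh rs z' w' in auto)
    then have "norm (Kgen f M n r s z w - Kinf f fp fm M r s z w) =
        norm (?F1 (1 / z)) * norm (?F2 (1 / w)) * norm (S - T)"
      using infsumI[OF K] by (simp add: Kgen_def norm_mult right_diff_distrib[symmetric])
    also have "\<dots> \<le> norm (?F1 (1 / z)) * norm (?F2 (1 / w)) * (C * (1 / ((norm z - 1) * (1 - norm w)) *
             (1 / real n powr \<alpha> + norm w powr (real n / 2) + 1 / norm z powr (real n / 2))))"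
      unfolding S_def T_def by (intro mult_left_mono C n det w z) auto
    finally show "Kgen_term f M n r s z w summable_on UNIV \<and>
             norm (Kgen f M n r s z w - Kinf f fp fm M r s z w)
               \<le> C * (norm (fprod f r M (1 / z)) * norm (fprod f (- M) s (1 / w))
                        / ((norm z - 1) * (1 - norm w))
                      * (1 / real n powr \<alpha> + norm w powr (real n / 2)
                           + 1 / norm z powr (real n / 2)))"
      using has_sum_imp_summable[OF K] by (simp add: mult_ac)
  qed
qed

end
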